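(* Consider the model $Y=\mu+\epsilon$ described in the context, suppose $\sigma_\mu^2>0$ and assumptions (C1)–(C3) hold. Let $\hat\sigma_\mu^2$ denote any one of $$\hat\sigma_{\mu,I}^2=\frac1n\|\hat\mu\|^2,\qquad \hat\sigma_{\mu,II}^2=\frac1n\sum_{m\in\mathcal M_{u_\gamma}}w_m\|P_mY\|^2,\qquad \hat\sigma_{\mu,III}^2=\frac1n\big(\|Y\|^2-\|Y-\hat\mu\|^2\big).$$ Then $\sqrt n(\hat\sigma_\mu^2-\sigma_\mu^2)\xrightarrow{d}\mathcal N(0,\kappa_\mu+4\sigma_\epsilon^2\sigma_\mu^2)$.
   Context: Asymptotics are as $n\to\infty$; $p=p_n$ and other quantities may depend on $n$. Notation: for $u\in\mathbb N$, $\mathcal M_u=\{m\subseteq\{1,\dots,p\}:|m|=u\}$; $Z_m$ is the submatrix of $Z\in\mathbb R^{n\times p}$ with columns in $m$, $P_m$ the orthogonal projection onto its column space, $P_m^\perp=I_n-P_m$. A random sequence $v\in\mathbb R^n$ is weakly sparse relative to $Z$ in probability with sparsity $s$ at rate $k$ if there are sets $S\in\mathcal M_s$ with $\|P_S^\perp v\|^2=o_p(k)$. A mean-zero real random variable is sub-Gaussian with parameter $K$ if $\mathbb E\exp(\lambda\xi)\le\exp(K^2\lambda^2/2)$ for all $\lambda\in\mathbb R$. Model: $Y=\mu+\epsilon$ with $Y,\mu,\epsilon\in\mathbb R^n$ and $Z$ observed along with $Y$. $\sigma_\mu^2=\mathrm{Var}(\mu_1)$, $\kappa_\mu=\mathrm{Var}(\mu_1^2)$,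 $\sigma_\epsilon^2=\mathrm{Var}(\epsilon_1)$, $\kappa_\epsilon=\mathrm{Var}(\epsilon_1^2)$. (C1) The entries of $\mu$ are i.i.d. with mean zero and finite fourth moment. (C2) $\epsilon$ is independent of $(Z,\mu)$, with i.i.d. sub-Gaussian entries with parameter $K_\epsilon$. (C3) $\mu$ is weakly sparse relative to $Z$ in probability with sparsity $s_\gamma$ at rate $\sqrt n$; the chosen integer $u_\gamma$ satisfies $u_\gamma\ge s_\gamma$ for all large $n$ and $u_\gamma=o(\sqrt n/\log p)$. Estimator: fix $\alpha_Y>4K_\epsilon^2$; $w_m=\exp(-\|P_m^\perp Y\|^2/\alpha_Y)/\sum_{k\in\mathcal M_{u_\gamma}}\exp(-\|P_k^\perp Y\|^2/\alpha_Y)$ for $m\in\mathcal M_{u_\gamma}$, and $\hat\mu=\sum_{m\in\mathcal M_{u_\gamma}}w_mP_mY$. *)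

theory Defs
  imports "HOL-Probability.Probability" "HOL-Library.Landau_Symbols"
begin

(* Vectors in R^n are represented as functions nat => real; only the entries
   0..n-1 matter.  An n x p matrix Z is a function nat => nat => real (Z i j),
   rows i < n, columns j < p.  Column index sets m are subsets of {..<p}. *)

definition sqnorm :: "nat \<Rightarrow> (nat \<Rightarrow> real) \<Rightarrow> real" where
  "sqnorm n v = (\<Sum>i<n. (v i)\<^sup>2)"

definition inprod :: "nat \<Rightarrow> (nat \<Rightarrow> real) \<Rightarrow> (nat \<Rightarrow> real) \<Rightarrow> real" where
  "inprod n v w = (\<Sum>i<n. v i * w i)"

definition colspace :: "nat \<Rightarrow> (nat \<Rightarrow> nat \<Rightarrow> real) \<Rightarrow> nat set \<Rightarrow> (nat \<Rightarrow> real) set" where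
  "colspace n Z m = {v. \<exists>\<beta>::nat \<Rightarrow> real. \<forall>i. v i = (if i < n then (\<Sum>j\<in>m. Z i j * \<beta> j) else 0)}"

definition proj :: "nat \<Rightarrow> (nat \<Rightarrow> nat \<Rightarrow> real) \<Rightarrow> nat set \<Rightarrow> (nat \<Rightarrow> real) \<Rightarrow> (nat \<Rightarrow> real)" where
  "proj n Z m y = (THE v. v \<in> colspace n Z m \<and> (\<forall>j\<in>m. inprod n (\<lambda>i. y i - v i) (\<lambda>i. Z i j) = 0))"

definition proj_perp :: "nat \<Rightarrow> (nat \<Rightarrow> nat \<Rightarrow> real) \<Rightarrow> nat set \<Rightarrow> (nat \<Rightarrow> real) \<Rightarrow> (nat \<Rightarrow> real)" where
  "proj_perp n Z m y = (\<lambda>i. y i - proj n Z m y i)"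

definition subsets_card :: "nat \<Rightarrow> nat \<Rightarrow> nat set set" where
  "subsets_card p u = {m. m \<subseteq> {..<p} \<and> card m = u}"

definition ew_weight :: "real \<Rightarrow> nat \<Rightarrow> nat \<Rightarrow> nat \<Rightarrow> (nat \<Rightarrow> nat \<Rightarrow> real) \<Rightarrow> (nat \<Rightarrow> real) \<Rightarrow> nat set \<Rightarrow> real" where
  "ew_weight \<alpha> n p u Z Y m =
     exp (- sqnorm n (proj_perp n Z m Y) / \<alpha>) /
     (\<Sum>k\<in>subsets_card p u. exp (- sqnorm n (proj_perp n Z k Y) / \<alpha>))"

definition mu_hat :: "real \<Rightarrow> nat \<Rightarrow> nat \<Rightarrow> nat \<Rightarrow> (nat \<Rightarrow> nat \<Rightarrow> real) \<Rightarrow> (nat \<Rightarrow> real) \<Rightarrow> (nat \<Rightarrow> real)" where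
  "mu_hat \<alpha> n p u Z Y = (\<lambda>i. \<Sum>m\<in>subsets_card p u. ew_weight \<alpha> n p u Z Y m * proj n Z m Y i)"

definition sigma_hat_I :: "real \<Rightarrow> nat \<Rightarrow> nat \<Rightarrow> nat \<Rightarrow> (nat \<Rightarrow> nat \<Rightarrow> real) \<Rightarrow> (nat \<Rightarrow> real) \<Rightarrow> real" where
  "sigma_hat_I \<alpha> n p u Z Y = sqnorm n (mu_hat \<alpha> n p u Z Y) / real n"

definition sigma_hat_II :: "real \<Rightarrow> nat \<Rightarrow> nat \<Rightarrow> nat \<Rightarrow> (nat \<Rightarrow> nat \<Rightarrow> real) \<Rightarrow> (nat \<Rightarrow> real) \<Rightarrow> real" where
  "sigma_hat_II \<alpha> n p u Z Y =
     (\<Sum>m\<in>subsets_card p u. ew_weight \<alpha> n p u Z Y m * sqnorm n (proj n Z m Y)) / real n"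

definition sigma_hat_III :: "real \<Rightarrow> nat \<Rightarrow> nat \<Rightarrow> nat \<Rightarrow> (nat \<Rightarrow> nat \<Rightarrow> real) \<Rightarrow> (nat \<Rightarrow> real) \<Rightarrow> real" where
  "sigma_hat_III \<alpha> n p u Z Y =
     (sqnorm n Y - sqnorm n (\<lambda>i. Y i - mu_hat \<alpha> n p u Z Y i)) / real n"

definition subgaussian :: "real measure \<Rightarrow> real \<Rightarrow> bool" where
  "subgaussian D K \<longleftrightarrow> integrable D (\<lambda>x. x) \<and> (\<integral>x. x \<partial>D) = 0 \<and>
     (\<forall>l::real. integrable D (\<lambda>x. exp (l * x)) \<and>
                (\<integral>x. exp (l * x) \<partial>D) \<le> exp (K\<^sup>2 * l\<^sup>2 / 2))"

definition normal_measure :: "real \<Rightarrow> real measure" where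
  "normal_measure v = (if v = 0 then return borel 0 else density lborel (normal_density 0 (sqrt v)))"

definition tendsto_prob_zero :: "'a measure \<Rightarrow> (nat \<Rightarrow> 'a \<Rightarrow> real) \<Rightarrow> bool" where
  "tendsto_prob_zero M X \<longleftrightarrow>
     (\<forall>e>0. (\<lambda>n. measure M {\<omega>\<in>space M. \<bar>X n \<omega>\<bar> > e}) \<longlonglongrightarrow> 0)"

end

theory Submission
  imports Defs
begin

text \<open>
  Write \<open>E\<close> for the squared norm of the noise. Uniformly over the models \<open>m\<close>, the
  residual sum of squares is at least \<open>E + d(m) / 2 - O(t)\<close>, where \<open>d(m)\<close> is the squared
  bias of \<open>m\<close> and \<open>t\<close> bounds the squared projection of the noise onto the span of \<open>mu\<close> and
  the columns in \<open>m\<close>. A Gaussian linearisation of the exponential moment of that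
  projection and a union bound over the at most \<open>p ^ u\<close> models give \<open>t = o(sqrt n)\<close> in
  probability. On the other hand, the Gibbs variational principle bounds the weighted mean of the
  residual sums of squares by \<open>E + o(sqrt n)\<close>. Hence that mean is \<open>E\<close> and the weighted bias is
  \<open>0\<close>, both up to \<open>o(sqrt n)\<close>, and each estimator multiplied by \<open>n\<close> differs
  from \<open>sum mu_i\<^sup>2 + 2 mu_i eps_i\<close> by \<open>o(sqrt n)\<close>. The central limit theorem for this
  sum and Slutsky's lemma conclude.
\<close>

section \<open>Projections onto column spaces\<close>

text \<open>What shapes the proof is the cross term of noise and bias in the residual: it is not
  small uniformly in \<open>m\<close>, since a poor model has a large bias. Divided by the length of
  the bias it is one more coordinate of the projected noise, so it is at most
  \<open>d(m) / 2 + 2 * t\<close>, and half of the bias survives. Hence \<open>mu\<close> is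
  adjoined to the columns of \<open>m\<close>: one exponential moment then controls both noise
  terms, and independence allows design and signal to be frozen. With variance proxy \<alpha>/4 and
  exponent 3/(2\<alpha>), each direction costs a factor 2. The logarithm of the number of models, at
  most \<open>u * ln p\<close>, is paid twice, in the union bound and in the Gibbs bound; (C3) makes
  both payments o(sqrt n). The noise energy E may itself fluctuate at order sqrt n, but it occurs in
  the squared norm of \<open>Y\<close> as well as in the residuals and cancels. The three estimators
  differ only by the weighted dispersion of the fits around their mean, which the weighted bias
  controls.\<close>

lemma inprod_commute: "inprod n v w = inprod n w v"
  by (simp add: inprod_def mult.commute)

lemma inprod_add_left: "inprod n (\<lambda>i. a i + b i) w = inprod n a w + inprod n b w"
  by (simp add: inprod_def algebra_simps sum.distrib)

lemma inprod_diff_left: "inprod n (\<lambda>i. a i - b i) w = inprod n a w - inprod n b w"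
  by (simp add: inprod_def algebra_simps sum_subtractf)

lemma inprod_scale_left: "inprod n (\<lambda>i. c * a i) w = c * inprod n a w"
  by (simp add: inprod_def sum_distrib_left mult_ac)

lemma inprod_diff_right: "inprod n w (\<lambda>i. a i - b i) = inprod n w a - inprod n w b"
  by (simp add: inprod_def algebra_simps sum_subtractf)

lemma inprod_scale_right: "inprod n w (\<lambda>i. c * a i) = c * inprod n w a"
  by (simp add: inprod_def sum_distrib_left mult_ac)

lemma inprod_sum_left: "inprod n (\<lambda>i. \<Sum>k\<in>I. f k i) w = (\<Sum>k\<in>I. inprod n (f k) w)"
  by (simp add: inprod_def sum_distrib_right) (rule sum.swap)

lemma sqnorm_eq_inprod: "sqnorm n v = inprod n v v"
  by (simp add: sqnorm_def inprod_def power2_eq_square)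

lemma sqnorm_nonneg [simp]: "0 \<le> sqnorm n v"
  by (simp add: sqnorm_def sum_nonneg)

lemma sqnorm_add: "sqnorm n (\<lambda>i. a i + b i) = sqnorm n a + sqnorm n b + 2 * inprod n a b"
  by (simp add: sqnorm_def inprod_def power2_eq_square algebra_simps sum.distrib sum_distrib_left)

lemma sqnorm_diff: "sqnorm n (\<lambda>i. a i - b i) = sqnorm n a + sqnorm n b - 2 * inprod n a b"
  by (simp add: sqnorm_def inprod_def power2_eq_square algebra_simps sum.distrib sum_subtractf
      sum_distrib_left)

lemma sqnorm_scale: "sqnorm n (\<lambda>i. c * a i) = c\<^sup>2 * sqnorm n a"
  by (simp add: sqnorm_def power_mult_distrib sum_distrib_left)

lemma sqnorm_eq_0_iff: "sqnorm n v = 0 \<longleftrightarrow> (\<forall>i<n. v i = 0)"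
  by (auto simp: sqnorm_def sum_nonneg_eq_0_iff)

section \<open>Column spaces as linear subspaces\<close>

lemma colspace_diff:
  assumes "v \<in> colspace n Z m" "w \<in> colspace n Z m"
  shows "(\<lambda>i. v i - w i) \<in> colspace n Z m"
proof -
  obtain b c where "\<forall>i. v i = (if i < n then (\<Sum>j\<in>m. Z i j * b j) else 0)"
    "\<forall>i. w i = (if i < n then (\<Sum>j\<in>m. Z i j * c j) else 0)"
    using assms unfolding colspace_def by blast
  then show ?thesis unfolding colspace_def
    by (auto intro!: exI[of _ "\<lambda>j. b j - c j"] simp: algebra_simps sum_subtractf)
qed

lemma colspace_add_scale:
  assumes "v \<in> colspace n Z m" "w \<in> colspace n Z m"
  shows "(\<lambda>i. v i + c * w i) \<in> colspace n Z m"
proof -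
  obtain a b where "\<forall>i. v i = (if i < n then (\<Sum>j\<in>m. Z i j * a j) else 0)"
    "\<forall>i. w i = (if i < n then (\<Sum>j\<in>m. Z i j * b j) else 0)"
    using assms unfolding colspace_def by blast
  then show ?thesis unfolding colspace_def
    by (auto intro!: exI[of _ "\<lambda>j. a j + c * b j"] simp: algebra_simps sum.distrib sum_distrib_left)
qed

lemma colspace_add:
  "v \<in> colspace n Z m \<Longrightarrow> w \<in> colspace n Z m \<Longrightarrow> (\<lambda>i. v i + w i) \<in> colspace n Z m"
  using colspace_add_scale[of v n Z m w 1] by simp

lemma colspace_outside: "v \<in> colspace n Z m \<Longrightarrow> n \<le> i \<Longrightarrow> v i = 0"
  by (auto simp: colspace_def)

lemma colspace_mono:
  assumes "m \<subseteq> m'" "finite m'"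
  shows "colspace n Z m \<subseteq> colspace n Z m'"
proof
  fix v assume "v \<in> colspace n Z m"
  then obtain b where b: "\<forall>i. v i = (if i < n then (\<Sum>j\<in>m. Z i j * b j) else 0)"
    unfolding colspace_def by blast
  have "(\<Sum>j\<in>m. Z i j * b j) = (\<Sum>j\<in>m'. Z i j * (if j \<in> m then b j else 0))" for i
    using assms by (intro sum.mono_neutral_cong_left) auto
  with b show "v \<in> colspace n Z m'" unfolding colspace_def
    by (auto intro!: exI[of _ "\<lambda>j. if j \<in> m then b j else 0"])
qed

lemma column_in_colspace:
  assumes "finite m" "j \<in> m"
  shows "(\<lambda>i. if i < n then Z i j else 0) \<in> colspace n Z m"
proof -
  have "(\<Sum>k\<in>m. Z i k * (if k = j then 1 else 0)) = Z i j" for i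
    using assms by (simp add: sum.delta if_distrib[of "(*) _"] cong: if_cong)
  then show ?thesis unfolding colspace_def
    by (auto intro!: exI[of _ "\<lambda>k. if k = j then 1 else 0"])
qed

lemma inprod_colspace_eq_0:
  assumes w: "w \<in> colspace n Z m" and orth: "\<And>j. j \<in> m \<Longrightarrow> inprod n v (\<lambda>i. Z i j) = 0"
  shows "inprod n v w = 0"
proof -
  obtain b where b: "\<forall>i. w i = (if i < n then (\<Sum>j\<in>m. Z i j * b j) else 0)"
    using w unfolding colspace_def by blast
  have "inprod n v w = (\<Sum>i<n. \<Sum>j\<in>m. v i * (Z i j * b j))"
    using b by (simp add: inprod_def sum_distrib_left)
  also have "\<dots> = (\<Sum>j\<in>m. b j * inprod n v (\<lambda>i. Z i j))"
    by (subst sum.swap) (simp add: inprod_def sum_distrib_left mult_ac)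
  finally show ?thesis using orth by simp
qed

text \<open>The normal equations, that is, the predicate under the description operator in
  \<open>proj\<close>. Members of \<open>colspace\<close> vanish from index \<open>n\<close> on,
  which makes the solution unique as a function on all indices.\<close>

definition is_proj :: "nat \<Rightarrow> (nat \<Rightarrow> nat \<Rightarrow> real) \<Rightarrow> nat set \<Rightarrow> (nat \<Rightarrow> real) \<Rightarrow> (nat \<Rightarrow> real) \<Rightarrow> bool" where
  "is_proj n Z m y v \<longleftrightarrow>
     v \<in> colspace n Z m \<and> (\<forall>j\<in>m. inprod n (\<lambda>i. y i - v i) (\<lambda>i. Z i j) = 0)"

text \<open>The difference of two solutions lies in the column space and is orthogonal to every
  column, hence to itself.\<close>

lemma is_proj_unique:
  assumes v: "is_proj n Z m y v" and w: "is_proj n Z m y w"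
  shows "v = w"
proof -
  define d where "d = (\<lambda>i. v i - w i)"
  have d: "d \<in> colspace n Z m"
    using v w colspace_diff unfolding is_proj_def d_def by blast
  have "inprod n d d = 0"
  proof (rule inprod_colspace_eq_0[OF d])
    fix j assume "j \<in> m"
    then have "inprod n (\<lambda>i. (y i - w i) - (y i - v i)) (\<lambda>i. Z i j) = 0"
      using v w by (simp only: is_proj_def inprod_diff_left[of n "\<lambda>i. y i - w i" "\<lambda>i. y i - v i"])
    then show "inprod n d (\<lambda>i. Z i j) = 0" by (simp add: d_def)
  qed
  then have "\<forall>i<n. d i = 0" by (simp add: sqnorm_eq_inprod[symmetric] sqnorm_eq_0_iff)
  moreover have "d i = 0" if "\<not> i < n" for i using colspace_outside[OF d] that by simp
  ultimately show ?thesis by (auto simp: d_def fun_eq_iff)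
qed

lemma proj_eqI: "is_proj n Z m y v \<Longrightarrow> proj n Z m y = v"
  unfolding proj_def is_proj_def[symmetric] by (rule the_equality) (auto dest: is_proj_unique)

text \<open>
  One Gram--Schmidt step. No case distinction is needed when the residual \<open>r\<close> of the new
  column vanishes, because then the quotient is \<open>0\<close>.
\<close>

lemma is_proj_insert:
  assumes fin: "finite m" and v: "is_proj n Z m y v" and w: "is_proj n Z m (\<lambda>i. Z i j) w"
  defines "r \<equiv> (\<lambda>i. if i < n then Z i j - w i else 0)"
  shows "is_proj n Z (insert j m) y (\<lambda>i. v i + inprod n y r / sqnorm n r * r i)"
proof -
  let ?c = "inprod n y r / sqnorm n r"
  let ?v = "\<lambda>i. v i + ?c * r i"
  have vC: "v \<in> colspace n Z m" and wC: "w \<in> colspace n Z m"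
    using v w by (auto simp: is_proj_def)
  have sub: "colspace n Z m \<subseteq> colspace n Z (insert j m)"
    using fin by (intro colspace_mono) auto
  have "(\<lambda>i. (if i < n then Z i j else 0) - w i) \<in> colspace n Z (insert j m)"
    using fin wC sub by (intro colspace_diff column_in_colspace) auto
  moreover have "(\<lambda>i. (if i < n then Z i j else 0) - w i) = r"
    using colspace_outside[OF wC] by (auto simp: r_def fun_eq_iff)
  ultimately have rC: "r \<in> colspace n Z (insert j m)" by simp
  have in1: "?v \<in> colspace n Z (insert j m)"
    using vC sub rC by (intro colspace_add_scale) auto
  have r_orth: "inprod n r (\<lambda>i. Z i k) = 0" if "k \<in> m" for k
  proof -
    have "inprod n r (\<lambda>i. Z i k) = inprod n (\<lambda>i. Z i j - w i) (\<lambda>i. Z i k)"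
      by (simp add: r_def inprod_def)
    then show ?thesis using w that by (simp add: is_proj_def)
  qed
  have rv: "inprod n r v = 0" and rw: "inprod n r w = 0"
    using inprod_colspace_eq_0 vC wC r_orth by blast+
  have expand: "inprod n (\<lambda>i. y i - ?v i) x = inprod n (\<lambda>i. y i - v i) x - ?c * inprod n r x" for x
    by (simp only: inprod_diff_left inprod_add_left inprod_scale_left)
  have resid_w: "inprod n (\<lambda>i. y i - v i) w = 0"
    using v inprod_colspace_eq_0[OF wC] by (auto simp: is_proj_def)
  have Zj: "inprod n x (\<lambda>i. Z i j) = inprod n x r + inprod n x w" for x
    by (simp add: inprod_def r_def sum.distrib[symmetric] algebra_simps)
  have "inprod n (\<lambda>i. y i - ?v i) (\<lambda>i. Z i j) = inprod n y r - ?c * inprod n r r"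
    using rv rw resid_w by (simp only: Zj[of "\<lambda>i. y i - ?v i"] expand)
      (simp add: inprod_diff_left inprod_commute[of n v r])
  also have "\<dots> = 0"
  proof (cases "sqnorm n r = 0")
    case True
    then have "inprod n y r = 0" by (simp add: sqnorm_eq_0_iff inprod_def)
    then show ?thesis by simp
  qed (simp add: sqnorm_eq_inprod)
  finally have "inprod n (\<lambda>i. y i - ?v i) (\<lambda>i. Z i j) = 0" .
  moreover have "inprod n (\<lambda>i. y i - ?v i) (\<lambda>i. Z i k) = 0" if "k \<in> m" for k
    using v that r_orth[OF that] by (simp only: expand) (simp add: is_proj_def)
  ultimately show ?thesis using in1 by (auto simp: is_proj_def)
qed

text \<open>Induction over the columns; \<open>y\<close> stays general because the step also
  projects the new column.\<close>

lemma is_proj_exists: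
  assumes "finite m"
  shows "\<exists>v. is_proj n Z m y v"
  using assms
proof (induction m arbitrary: y)
  case empty
  have "is_proj n Z {} y (\<lambda>_. 0)" by (simp add: is_proj_def colspace_def)
  then show ?case by blast
next
  case (insert j m)
  then obtain v w where "is_proj n Z m y v" "is_proj n Z m (\<lambda>i. Z i j) w" by metis
  then show ?case using is_proj_insert[OF insert(1)] by blast
qed

lemma is_proj_proj: "finite m \<Longrightarrow> is_proj n Z m y (proj n Z m y)"
  using is_proj_exists[of m n Z y] proj_eqI[of n Z m y] by auto

lemma proj_in_colspace: "finite m \<Longrightarrow> proj n Z m y \<in> colspace n Z m"
  using is_proj_proj[of m n Z y] by (auto simp: is_proj_def)

lemma proj_perp_orth_column:
  "finite m \<Longrightarrow> j \<in> m \<Longrightarrow> inprod n (proj_perp n Z m y) (\<lambda>i. Z i j) = 0"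
  using is_proj_proj[of m n Z y] by (auto simp: is_proj_def proj_perp_def)

lemma proj_perp_orth:
  "finite m \<Longrightarrow> w \<in> colspace n Z m \<Longrightarrow> inprod n (proj_perp n Z m y) w = 0"
  by (rule inprod_colspace_eq_0) (auto intro: proj_perp_orth_column)

lemma proj_empty: "proj n Z {} y = (\<lambda>_. 0)"
  by (rule proj_eqI) (simp add: is_proj_def colspace_def)

text \<open>The recursion that replaces the description operator in inductions over columns. The
  test \<open>i < n\<close> appears because \<open>r\<close> keeps the entries of \<open>Z\<close>
  beyond the vector length.\<close>

lemma proj_insert:
  fixes n :: nat and Z :: "nat \<Rightarrow> nat \<Rightarrow> real" and j :: nat
  assumes "finite m"
  defines "r \<equiv> proj_perp n Z m (\<lambda>i. Z i j)"
  shows "proj n Z (insert j m) y =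
    (\<lambda>i. if i < n then proj n Z m y i + inprod n y r / sqnorm n r * r i else 0)"
proof -
  have eq: "proj n Z (insert j m) y = (\<lambda>i. proj n Z m y i +
      inprod n y (\<lambda>i. if i < n then r i else 0) / sqnorm n (\<lambda>i. if i < n then r i else 0)
        * (if i < n then r i else 0))"
    unfolding r_def proj_perp_def
    by (rule proj_eqI[OF is_proj_insert[OF assms(1) is_proj_proj[OF assms(1), of n Z y]
          is_proj_proj[OF assms(1), of n Z "\<lambda>i. Z i j"]]])
  have *: "inprod n y (\<lambda>i. if i < n then r i else 0) = inprod n y r"
    "sqnorm n (\<lambda>i. if i < n then r i else 0) = sqnorm n r"
    by (simp_all add: inprod_def sqnorm_def)
  have "proj n Z m y i = 0" if "\<not> i < n" for i
    using colspace_outside[OF proj_in_colspace[OF assms(1), of n Z y]] that by simp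
  then show ?thesis unfolding eq * by (intro ext) simp
qed

text \<open>Permits two replacements later: extending the matrix by a column outside
  \<open>m\<close>, and restricting the noise to its first \<open>n\<close> coordinates.\<close>

lemma proj_cong:
  assumes "\<And>i j. i < n \<Longrightarrow> j \<in> m \<Longrightarrow> Z i j = Z' i j" "\<And>i. i < n \<Longrightarrow> y i = y' i"
  shows "proj n Z m y = proj n Z' m y'"
proof -
  have "(\<Sum>j\<in>m. Z i j * b j) = (\<Sum>j\<in>m. Z' i j * b j)" if "i < n" for i b
    using assms(1) that by (intro sum.cong) auto
  then have "colspace n Z m = colspace n Z' m"
    unfolding colspace_def by (auto split: if_splits)
  moreover have "inprod n (\<lambda>i. y i - v i) (\<lambda>i. Z i j) = inprod n (\<lambda>i. y' i - v i) (\<lambda>i. Z' i j)"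
    if "j \<in> m" for v j
    using assms that by (auto simp: inprod_def intro!: sum.cong)
  ultimately have "(\<lambda>v. v \<in> colspace n Z m \<and> (\<forall>j\<in>m. inprod n (\<lambda>i. y i - v i) (\<lambda>i. Z i j) = 0)) =
      (\<lambda>v. v \<in> colspace n Z' m \<and> (\<forall>j\<in>m. inprod n (\<lambda>i. y' i - v i) (\<lambda>i. Z' i j) = 0))"
    by auto
  then show ?thesis unfolding proj_def by (rule arg_cong)
qed

section \<open>Linearity, Pythagoras and monotonicity of projections\<close>

lemma proj_add:
  assumes "finite m"
  shows "proj n Z m (\<lambda>i. a i + b i) = (\<lambda>i. proj n Z m a i + proj n Z m b i)"
proof (rule proj_eqI)
  have "inprod n (\<lambda>i. a i + b i - (proj n Z m a i + proj n Z m b i)) (\<lambda>i. Z i j) =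
    inprod n (proj_perp n Z m a) (\<lambda>i. Z i j) + inprod n (proj_perp n Z m b) (\<lambda>i. Z i j)" for j
    by (simp add: inprod_def proj_perp_def sum.distrib[symmetric] algebra_simps)
  then show "is_proj n Z m (\<lambda>i. a i + b i) (\<lambda>i. proj n Z m a i + proj n Z m b i)"
    using assms by (simp add: is_proj_def colspace_add proj_in_colspace proj_perp_orth_column)
qed

lemma proj_perp_add:
  "finite m \<Longrightarrow> proj_perp n Z m (\<lambda>i. a i + b i) = (\<lambda>i. proj_perp n Z m a i + proj_perp n Z m b i)"
  by (simp add: proj_perp_def proj_add fun_eq_iff)

lemma inprod_proj_perp_proj: "finite m \<Longrightarrow> inprod n (proj_perp n Z m a) (proj n Z m b) = 0"
  by (simp add: proj_perp_orth proj_in_colspace)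

lemma sqnorm_pythagoras:
  assumes "finite m"
  shows "sqnorm n y = sqnorm n (proj n Z m y) + sqnorm n (proj_perp n Z m y)"
proof -
  have "sqnorm n y = sqnorm n (\<lambda>i. proj_perp n Z m y i + proj n Z m y i)"
    by (simp add: proj_perp_def)
  then show ?thesis using inprod_proj_perp_proj[OF assms] by (simp add: sqnorm_add)
qed

text \<open>The complementary projection is self-adjoint and idempotent; this moves the cross term
  of \<open>mu\<close> and \<open>e\<close> onto the full noise vector.\<close>

lemma inprod_proj_perp: 
  assumes "finite m"
  shows "inprod n (proj_perp n Z m a) (proj_perp n Z m b) = inprod n b (proj_perp n Z m a)"
proof -
  have "inprod n (proj_perp n Z m a) (proj_perp n Z m b) = inprod n (proj_perp n Z m a) b"
    using inprod_proj_perp_proj[OF assms, of n Z a b]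
    unfolding proj_perp_def[of n Z m b] inprod_diff_right by simp
  then show ?thesis by (subst inprod_commute[of n b])
qed

text \<open>Enlarging the model changes the projection by a vector of the larger space, orthogonal
  to the new residual. So the sparse set \<open>S n\<close> may be replaced by a model of size
  \<open>u n\<close>.\<close>

lemma sqnorm_proj_perp_mono:
  assumes "m \<subseteq> m'" "finite m'"
  shows "sqnorm n (proj_perp n Z m' y) \<le> sqnorm n (proj_perp n Z m y)"
proof -
  have fin: "finite m" using assms finite_subset by blast
  define d where "d = (\<lambda>i. proj n Z m' y i - proj n Z m y i)"
  have "d \<in> colspace n Z m'" unfolding d_def
    using colspace_mono[OF assms] proj_in_colspace fin assms(2) by (intro colspace_diff) blast+
  then have 0: "inprod n (proj_perp n Z m' y) d = 0" using proj_perp_orth assms by blast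
  have "sqnorm n (proj_perp n Z m y) = sqnorm n (\<lambda>i. proj_perp n Z m' y i + d i)"
    by (simp add: proj_perp_def d_def)
  then show ?thesis using 0 by (simp add: sqnorm_add)
qed

text \<open>Pythagoras: the new column contributes the squared component of \<open>y\<close> along
  its residual. This quotient is the term that the Gaussian variable linearises.\<close>

lemma sqnorm_proj_insert:
  fixes n :: nat and Z :: "nat \<Rightarrow> nat \<Rightarrow> real" and j :: nat
  assumes fin: "finite m"
  defines "r \<equiv> proj_perp n Z m (\<lambda>i. Z i j)"
  shows "sqnorm n (proj n Z (insert j m) y) =
    sqnorm n (proj n Z m y) + (inprod n y r)\<^sup>2 / sqnorm n r"
proof -
  let ?c = "inprod n y r / sqnorm n r"
  have "sqnorm n (proj n Z (insert j m) y) = sqnorm n (\<lambda>i. proj n Z m y i + ?c * r i)"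
    by (simp add: proj_insert[OF fin] r_def sqnorm_def)
  also have "\<dots> = sqnorm n (proj n Z m y) + ?c\<^sup>2 * sqnorm n r"
    using inprod_proj_perp_proj[OF fin, of n Z "\<lambda>i. Z i j" y]
    by (simp only: sqnorm_add sqnorm_scale inprod_scale_right)
       (simp add: r_def[symmetric] inprod_commute)
  finally show ?thesis by (simp add: power2_eq_square)
qed

section \<open>Measurability of projections in design and response\<close>

lemma measurable_sqnorm:
  "(\<And>i. i < n \<Longrightarrow> (\<lambda>\<omega>. v \<omega> i) \<in> borel_measurable M) \<Longrightarrow> (\<lambda>\<omega>. sqnorm n (v \<omega>)) \<in> borel_measurable M"
  unfolding sqnorm_def by (intro borel_measurable_sum borel_measurable_power) auto

lemma measurable_inprod:
  "(\<And>i. i < n \<Longrightarrow> (\<lambda>\<omega>. v \<omega> i) \<in> borel_measurable M) \<Longrightarrow>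
   (\<And>i. i < n \<Longrightarrow> (\<lambda>\<omega>. w \<omega> i) \<in> borel_measurable M) \<Longrightarrow>
   (\<lambda>\<omega>. inprod n (v \<omega>) (w \<omega>)) \<in> borel_measurable M"
  unfolding inprod_def by (intro borel_measurable_sum borel_measurable_times) auto

lemma measurable_proj:
  assumes "finite m"
    and Z: "\<And>i j. i < n \<Longrightarrow> j \<in> m \<Longrightarrow> (\<lambda>\<omega>. Z \<omega> i j) \<in> borel_measurable M"
    and y: "\<And>i. i < n \<Longrightarrow> (\<lambda>\<omega>. y \<omega> i) \<in> borel_measurable M"
  shows "(\<lambda>\<omega>. proj n (Z \<omega>) m (y \<omega>) i) \<in> borel_measurable M"
  using assms
proof (induction m arbitrary: y i)
  case empty
  then show ?case by (simp add: proj_empty)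
next
  case (insert j m)
  let ?r = "\<lambda>\<omega>. proj_perp n (Z \<omega>) m (\<lambda>i. Z \<omega> i j)"
  have r: "(\<lambda>\<omega>. ?r \<omega> i) \<in> borel_measurable M" if "i < n" for i
    unfolding proj_perp_def using insert.prems that
    by (intro borel_measurable_diff insert.IH) auto
  have p: "(\<lambda>\<omega>. proj n (Z \<omega>) m (y \<omega>) i) \<in> borel_measurable M"
    using insert.prems by (intro insert.IH) auto
  show ?case
  proof (cases "i < n")
    case True
    then show ?thesis
      unfolding proj_insert[OF insert(1)] using r p insert.prems(2)
      by (simp add: borel_measurable_add borel_measurable_times borel_measurable_divide
          measurable_inprod measurable_sqnorm)
  qed (simp add: proj_insert[OF insert(1)])
qed

section \<open>Models as column sets of fixed size\<close>

lemma finite_subsets_card [simp]: "finite (subsets_card p u)"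
  unfolding subsets_card_def by (rule finite_subset[of _ "Pow {..<p}"]) auto

lemma finite_of_subsets_card: "m \<in> subsets_card p u \<Longrightarrow> finite m"
  using finite_subset by (auto simp: subsets_card_def)

lemma card_subsets_card: "card (subsets_card p u) = p choose u"
  unfolding subsets_card_def using n_subsets[of "{..<p}" u] by simp

lemma subsets_card_extend:
  assumes "m \<in> subsets_card p s" "s \<le> u" "u \<le> p"
  obtains m' where "m \<subseteq> m'" "m' \<in> subsets_card p u"
proof -
  have m: "m \<subseteq> {..<p}" "card m = s" using assms by (auto simp: subsets_card_def)
  obtain m' where "m \<subseteq> m'" "m' \<subseteq> {..<p}" "card m' = u"
    using exists_subset_between[of m u "{..<p}"] m assms by auto
  then show ?thesis using that by (auto simp: subsets_card_def)
qed

section \<open>Deterministic bounds for the exponentially weighted estimators\<close>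

text \<open>Jensen's inequality for the logarithm: with \<open>x m = (D m - D k) / \<alpha>\<close>,
  the weighted mean of \<open>x\<close> is at most the logarithm of the weighted mean of
  \<open>exp x\<close>. The latter mean is \<open>card I / S\<close>, and \<open>S\<close> is at
  least 1 through its term at \<open>k\<close>.\<close>

lemma gibbs_mean_le:
  fixes D :: "'b \<Rightarrow> real"
  assumes fin: "finite I" and k: "k \<in> I" and \<alpha>: "\<alpha> > 0"
  defines "w \<equiv> (\<lambda>m. exp (- D m / \<alpha>) / (\<Sum>k\<in>I. exp (- D k / \<alpha>)))"
  shows "(\<Sum>m\<in>I. w m * D m) \<le> D k + \<alpha> * ln (card I)"
proof -
  define x where "x m = (D m - D k) / \<alpha>" for m
  define S where "S = (\<Sum>m\<in>I. exp (- x m))"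
  have "exp (- x k) \<le> S" unfolding S_def using fin k by (intro member_le_sum) auto
  then have S1: "1 \<le> S" by (simp add: x_def)
  have N: "card I > 0" using fin k by (auto simp: card_gt_0_iff)
  define C where "C = exp (- D k / \<alpha>)"
  have shift: "exp (- D m / \<alpha>) = C * exp (- x m)" for m
    using \<alpha> by (simp add: C_def x_def exp_add[symmetric] field_simps)
  have w: "w m = exp (- x m) / S" for m
    unfolding w_def shift sum_distrib_left[symmetric] S_def by (simp add: C_def)
  have sumw: "(\<Sum>m\<in>I. w m) = 1"
    unfolding w sum_divide_distrib[symmetric] using S1 by (simp add: S_def)
  define c where "c = card I / S"
  have c: "c > 0" using N S1 by (simp add: c_def)
  \<comment> \<open>The tangent of \<open>ln\<close> at \<open>c\<close>, which is the weighted mean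
    of \<open>exp x\<close>; averaging it leaves \<open>ln c\<close>.\<close>
  have tangent: "x m \<le> exp (x m) / c - 1 + ln c" for m
    using ln_le_minus_one[of "exp (x m) / c"] c by (simp add: ln_div)
  have "(\<Sum>m\<in>I. w m * x m) \<le> (\<Sum>m\<in>I. w m * (exp (x m) / c - 1 + ln c))"
    using S1 by (intro sum_mono mult_left_mono tangent) (simp add: w)
  also have "\<dots> = (\<Sum>m\<in>I. w m * exp (x m)) / c + (ln c - 1) * (\<Sum>m\<in>I. w m)"
    by (simp add: sum_divide_distrib sum_distrib_left sum.distrib[symmetric] algebra_simps)
  also have "(\<Sum>m\<in>I. w m * exp (x m)) = c"
    by (simp add: w c_def exp_minus field_simps)
  also have "c / c + (ln c - 1) * (\<Sum>m\<in>I. w m) = ln c"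
    using c by (simp add: sumw)
  also have "ln c \<le> ln (card I)"
    using N S1 c by (intro ln_mono) (auto simp: c_def divide_le_eq mult_le_cancel_left1)
  finally have "(\<Sum>m\<in>I. w m * x m) \<le> ln (card I)" .
  then have "\<alpha> * (\<Sum>m\<in>I. w m * x m) \<le> \<alpha> * ln (card I)"
    using \<alpha> by simp
  moreover have "\<alpha> * (\<Sum>m\<in>I. w m * x m) = (\<Sum>m\<in>I. w m * D m) - D k * (\<Sum>m\<in>I. w m)"
    using \<alpha> by (simp add: sum_distrib_left x_def sum_subtractf[symmetric] right_diff_distrib
        diff_divide_distrib mult.commute[of "D k"])
  ultimately show ?thesis by (simp add: sumw)
qed

section \<open>The exponential weights and the relations between the three estimators\<close>

lemma ew_weight_nonneg: "0 \<le> ew_weight \<alpha> n p u Z Y m"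
  by (simp add: ew_weight_def sum_nonneg)

lemma sum_ew_weight:
  assumes "u \<le> p"
  shows "(\<Sum>m\<in>subsets_card p u. ew_weight \<alpha> n p u Z Y m) = 1"
proof -
  have "subsets_card p u \<noteq> {}"
    using assms card_subsets_card[of p u] by (metis card.empty less_irrefl zero_less_binomial)
  then have "(\<Sum>k\<in>subsets_card p u. exp (- sqnorm n (proj_perp n Z k Y) / \<alpha>)) > 0"
    by (intro sum_pos) auto
  then show ?thesis unfolding ew_weight_def by (simp add: sum_divide_distrib[symmetric])
qed

text \<open>The weighted variance of the fits around \<open>mu_hat\<close>. Divided by
  \<open>n\<close>, it is the gap between estimators II and I, and also between III and II.\<close>

definition ew_dispersion ::
    "real \<Rightarrow> nat \<Rightarrow> nat \<Rightarrow> nat \<Rightarrow> (nat \<Rightarrow> nat \<Rightarrow> real) \<Rightarrow> (nat \<Rightarrow> real) \<Rightarrow> real" where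
  "ew_dispersion \<alpha> n p u Z Y =
     (\<Sum>m\<in>subsets_card p u. ew_weight \<alpha> n p u Z Y m *
        sqnorm n (\<lambda>i. proj n Z m Y i - mu_hat \<alpha> n p u Z Y i))"

lemma inprod_mu_hat:
  "inprod n (mu_hat \<alpha> n p u Z Y) x =
     (\<Sum>m\<in>subsets_card p u. ew_weight \<alpha> n p u Z Y m * inprod n (proj n Z m Y) x)"
  by (simp add: mu_hat_def inprod_sum_left inprod_scale_left)

text \<open>A weighted second moment splits into variance and squared shift. Taking \<open>c\<close>
  as \<open>0\<close>, \<open>Y\<close> and \<open>mu\<close> serves estimator I, estimator III and
  the bound on the dispersion.\<close>

lemma weighted_sqnorm_diff:
  assumes "u \<le> p"
  shows "(\<Sum>m\<in>subsets_card p u. ew_weight \<alpha> n p u Z Y m * sqnorm n (\<lambda>i. proj n Z m Y i - c i)) =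
    ew_dispersion \<alpha> n p u Z Y + sqnorm n (\<lambda>i. mu_hat \<alpha> n p u Z Y i - c i)"
proof -
  let ?I = "subsets_card p u" and ?w = "ew_weight \<alpha> n p u Z Y" and ?h = "mu_hat \<alpha> n p u Z Y"
  have gen: "(\<Sum>m\<in>?I. ?w m * sqnorm n (\<lambda>i. proj n Z m Y i - c i)) =
      (\<Sum>m\<in>?I. ?w m * sqnorm n (proj n Z m Y)) + sqnorm n c - 2 * inprod n ?h c" for c
  proof -
    have "(\<Sum>m\<in>?I. ?w m * sqnorm n (\<lambda>i. proj n Z m Y i - c i)) =
        (\<Sum>m\<in>?I. ?w m * sqnorm n (proj n Z m Y) + sqnorm n c * ?w m
           - 2 * (?w m * inprod n (proj n Z m Y) c))"
      by (intro sum.cong refl) (simp add: sqnorm_diff algebra_simps)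
    also have "\<dots> = (\<Sum>m\<in>?I. ?w m * sqnorm n (proj n Z m Y)) + sqnorm n c * (\<Sum>m\<in>?I. ?w m)
           - 2 * inprod n ?h c"
      by (simp add: sum.distrib sum_subtractf sum_distrib_left inprod_mu_hat)
    finally show ?thesis by (simp add: sum_ew_weight[OF assms])
  qed
  show ?thesis
    unfolding ew_dispersion_def gen by (simp add: sqnorm_diff sqnorm_eq_inprod)
qed

lemma sigma_hat_I_eq:
  assumes "u \<le> p"
  shows "sigma_hat_I \<alpha> n p u Z Y = sigma_hat_II \<alpha> n p u Z Y - ew_dispersion \<alpha> n p u Z Y / n"
  using weighted_sqnorm_diff[OF assms, of \<alpha> n Z Y "\<lambda>_. 0"]
  by (simp add: sigma_hat_I_def sigma_hat_II_def diff_divide_distrib[symmetric])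

text \<open>Pythagoras under the weights; through this identity the Gibbs bound on the mean residual
  reaches estimator II.\<close>

lemma weighted_resid:
  assumes "u \<le> p"
  shows "(\<Sum>m\<in>subsets_card p u. ew_weight \<alpha> n p u Z Y m * sqnorm n (proj_perp n Z m Y)) =
    sqnorm n Y - n * sigma_hat_II \<alpha> n p u Z Y"
proof (cases "n = 0")
  case False
  have "(\<Sum>m\<in>subsets_card p u. ew_weight \<alpha> n p u Z Y m * sqnorm n (proj_perp n Z m Y)) =
    (\<Sum>m\<in>subsets_card p u. sqnorm n Y * ew_weight \<alpha> n p u Z Y m
       - ew_weight \<alpha> n p u Z Y m * sqnorm n (proj n Z m Y))"
  proof (rule sum.cong[OF refl])
    fix m assume "m \<in> subsets_card p u"
    then have "sqnorm n Y = sqnorm n (proj n Z m Y) + sqnorm n (proj_perp n Z m Y)"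
      by (intro sqnorm_pythagoras finite_of_subsets_card)
    then show "ew_weight \<alpha> n p u Z Y m * sqnorm n (proj_perp n Z m Y) =
        sqnorm n Y * ew_weight \<alpha> n p u Z Y m - ew_weight \<alpha> n p u Z Y m * sqnorm n (proj n Z m Y)"
      by (simp add: algebra_simps)
  qed
  then show ?thesis using False
    by (simp add: sum_subtractf sum_distrib_left[symmetric] sum_ew_weight[OF assms] sigma_hat_II_def)
qed (simp add: sqnorm_def)

lemma sigma_hat_III_eq:
  assumes "u \<le> p"
  shows "sigma_hat_III \<alpha> n p u Z Y = sigma_hat_II \<alpha> n p u Z Y + ew_dispersion \<alpha> n p u Z Y / n"
proof (cases "n = 0")
  case False
  let ?h = "mu_hat \<alpha> n p u Z Y"
  have swap: "sqnorm n (\<lambda>i. a i - b i) = sqnorm n (\<lambda>i. b i - a i)" for a b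
    by (simp add: sqnorm_def power2_commute)
  have "(\<Sum>m\<in>subsets_card p u. ew_weight \<alpha> n p u Z Y m * sqnorm n (proj_perp n Z m Y)) =
      ew_dispersion \<alpha> n p u Z Y + sqnorm n (\<lambda>i. Y i - ?h i)"
    unfolding proj_perp_def swap[of Y] by (rule weighted_sqnorm_diff[OF assms])
  then have "sqnorm n Y - sqnorm n (\<lambda>i. Y i - ?h i) =
      n * sigma_hat_II \<alpha> n p u Z Y + ew_dispersion \<alpha> n p u Z Y"
    using weighted_resid[OF assms, of \<alpha> n Z Y] by simp
  then show ?thesis using False by (simp add: sigma_hat_III_def add_divide_distrib)
qed (simp add: sigma_hat_II_def sigma_hat_III_def)

text \<open>From \<open>2 * sqrt (t * d) \<le> d / 2 + 2 * t\<close>. The coefficient of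
  \<open>d\<close> must be below 1, so that the lower bound on the residual keeps part of the
  bias.\<close>

lemma two_abs_le_of_sq_le:
  fixes x t d :: real
  assumes "x\<^sup>2 \<le> t * d" "0 \<le> t" "0 \<le> d"
  shows "2 * \<bar>x\<bar> \<le> d / 2 + 2 * t"
proof (rule power2_le_imp_le)
  have "(2 * \<bar>x\<bar>)\<^sup>2 \<le> 4 * (t * d)" using assms(1) by (simp add: power_mult_distrib)
  also have "\<dots> \<le> (d / 2 + 2 * t)\<^sup>2"
    using zero_le_power2[of "d / 2 - 2 * t"] by (simp add: power2_eq_square algebra_simps)
  finally show "(2 * \<bar>x\<bar>)\<^sup>2 \<le> (d / 2 + 2 * t)\<^sup>2" .
  show "0 \<le> d / 2 + 2 * t" using assms by simp
qed

text \<open>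
  The hypothesis \<open>noise\<close> bounds the squared length of the projection of \<open>e\<close> onto the span of
  \<open>mu\<close> and the columns in \<open>m\<close>.
\<close>

lemma ew_estimators_deterministic:
  fixes mu e :: "nat \<Rightarrow> real"
  assumes "u \<le> p" and \<alpha>: "\<alpha> > 0" and k: "k \<in> subsets_card p u"
    and approx: "sqnorm n (proj_perp n Z k mu) \<le> q"
    and noise: "\<And>m. m \<in> subsets_card p u \<Longrightarrow>
      sqnorm n (proj n Z m e) + (inprod n e (proj_perp n Z m mu))\<^sup>2 / sqnorm n (proj_perp n Z m mu) \<le> t"
    and est: "est \<in> {sigma_hat_I, sigma_hat_II, sigma_hat_III}"
  shows "\<bar>n * est \<alpha> n p u Z (\<lambda>i. mu i + e i) - (sqnorm n mu + 2 * inprod n mu e)\<bar>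
    \<le> 14 * t + 5 * q + 3 * (\<alpha> * ln (card (subsets_card p u)))"
proof -
  define Y where "Y = (\<lambda>i. mu i + e i)"
  let ?I = "subsets_card p u" and ?w = "ew_weight \<alpha> n p u Z Y"
  define A where "A = \<alpha> * ln (card ?I)"
  define D where "D m = sqnorm n (proj_perp n Z m Y)" for m
  define d where "d m = sqnorm n (proj_perp n Z m mu)" for m
  define r where "r m = sqnorm n (proj n Z m e)" for m
  define x where "x m = inprod n e (proj_perp n Z m mu)" for m
  \<comment> \<open>The noise energy, common to all models, is split off; \<open>r m\<close> is the
    part of it that the model absorbs.\<close>
  have D: "D m = sqnorm n e - r m + d m + 2 * x m" if "m \<in> ?I" for m
  proof -
    have fin: "finite m" using that by (rule finite_of_subsets_card)
    show ?thesis
      using sqnorm_pythagoras[OF fin, of n e Z]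
      by (simp add: D_def r_def d_def x_def Y_def proj_perp_add[OF fin] sqnorm_add
          inprod_proj_perp[OF fin])
  qed
  have d0: "0 \<le> d m" and r0: "0 \<le> r m" for m by (simp_all add: d_def r_def)
  have rt: "r m \<le> t" and xt: "2 * \<bar>x m\<bar> \<le> d m / 2 + 2 * t" if "m \<in> ?I" for m
  proof -
    have le: "r m + (x m)\<^sup>2 / d m \<le> t" using noise[OF that] by (simp add: r_def x_def d_def)
    moreover have "0 \<le> (x m)\<^sup>2 / d m" using d0 by simp
    ultimately show rt: "r m \<le> t" by linarith
    have "(x m)\<^sup>2 \<le> t * d m"
    \<comment> \<open>With zero bias the quotient in \<open>noise\<close> is \<open>0\<close> by
      convention and gives no bound on \<open>x m\<close>, but then \<open>x m\<close> itself
      vanishes.\<close>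
    proof (cases "d m = 0")
      case True
      then have "x m = 0" by (simp add: d_def x_def sqnorm_eq_0_iff inprod_def)
      then show ?thesis using True by simp
    next
      case False
      have "(x m)\<^sup>2 / d m \<le> t" using le r0[of m] by linarith
      then show ?thesis using False d0[of m] by (simp add: divide_le_eq)
    qed
    moreover have "0 \<le> t" using rt r0[of m] by linarith
    ultimately show "2 * \<bar>x m\<bar> \<le> d m / 2 + 2 * t" using d0 by (intro two_abs_le_of_sq_le)
  qed
  have t0: "0 \<le> t" using rt[OF k] r0[of k] by linarith
  have q0: "0 \<le> q" using sqnorm_nonneg approx by (rule order_trans)
  have "?I \<noteq> {}" using k by auto
  then have "1 \<le> card ?I" using card_gt_0_iff[of ?I] by (simp add: Suc_leI)
  then have A0: "0 \<le> A" unfolding A_def using \<alpha> by simp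
  have w0: "0 \<le> ?w m" for m by (rule ew_weight_nonneg)
  have w1: "(\<Sum>m\<in>?I. ?w m) = 1" by (rule sum_ew_weight) fact
  have wc: "(\<Sum>m\<in>?I. ?w m * c) = c" for c
    using w1 by (simp add: sum_distrib_right[symmetric])
  \<comment> \<open>The Gibbs bound with comparison model \<open>k\<close>, whose bias is at most
    \<open>q\<close>; its cross term adds \<open>q / 2 + 2 * t\<close>.\<close>
  have upper: "(\<Sum>m\<in>?I. ?w m * D m) \<le> sqnorm n e + 3 / 2 * q + 2 * t + A"
  proof -
    have "(\<Sum>m\<in>?I. ?w m * D m) \<le> D k + A"
      unfolding ew_weight_def A_def D_def using gibbs_mean_le[OF _ k \<alpha>] by simp
    moreover have "D k \<le> sqnorm n e + 3 / 2 * q + 2 * t"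
      using D[OF k] r0[of k] approx xt[OF k] by (simp add: d_def)
    ultimately show ?thesis by simp
  qed
  have lower: "sqnorm n e - 3 * t + (\<Sum>m\<in>?I. ?w m * d m) / 2 \<le> (\<Sum>m\<in>?I. ?w m * D m)"
  proof -
    have "(\<Sum>m\<in>?I. ?w m * (sqnorm n e - 3 * t + d m / 2)) \<le> (\<Sum>m\<in>?I. ?w m * D m)"
    proof (intro sum_mono mult_left_mono w0)
      fix m assume "m \<in> ?I"
      then show "sqnorm n e - 3 * t + d m / 2 \<le> D m"
        using D[of m] rt[of m] xt[of m] by linarith
    qed
    moreover have "(\<Sum>m\<in>?I. ?w m * (sqnorm n e - 3 * t + d m / 2)) =
        sqnorm n e - 3 * t + (\<Sum>m\<in>?I. ?w m * d m) / 2"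
      unfolding distrib_left sum.distrib wc by (simp add: sum_divide_distrib)
    ultimately show ?thesis by simp
  qed
  have wd0: "0 \<le> (\<Sum>m\<in>?I. ?w m * d m)" using w0 d0 by (intro sum_nonneg) simp
  \<comment> \<open>Both bounds enclose the same mean, so the noise energy cancels and the weighted
    bias is left.\<close>
  have wd: "(\<Sum>m\<in>?I. ?w m * d m) \<le> 10 * t + 3 * q + 2 * A" using upper lower by linarith
  define T where "T = sqnorm n mu + 2 * inprod n mu e"
  have "n * sigma_hat_II \<alpha> n p u Z Y = sqnorm n Y - (\<Sum>m\<in>?I. ?w m * D m)"
    using weighted_resid[OF \<open>u \<le> p\<close>, of \<alpha> n Z Y] by (simp add: D_def)
  moreover have "sqnorm n Y = T + sqnorm n e" by (simp add: Y_def sqnorm_add T_def)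
  ultimately have II: "\<bar>n * sigma_hat_II \<alpha> n p u Z Y - T\<bar> \<le> 3 * t + 3 / 2 * q + A"
    using upper lower wd0 t0 q0 A0 by linarith
  have V0: "0 \<le> ew_dispersion \<alpha> n p u Z Y"
    unfolding ew_dispersion_def using w0 by (intro sum_nonneg) simp
  have V: "ew_dispersion \<alpha> n p u Z Y \<le> 11 * t + 3 * q + 2 * A"
  proof -
    have "ew_dispersion \<alpha> n p u Z Y \<le> (\<Sum>m\<in>?I. ?w m * sqnorm n (\<lambda>i. proj n Z m Y i - mu i))"
      by (simp add: weighted_sqnorm_diff[OF \<open>u \<le> p\<close>])
    also have "\<dots> \<le> (\<Sum>m\<in>?I. ?w m * (t + d m))"
    proof (intro sum_mono mult_left_mono w0)
      fix m assume m: "m \<in> ?I"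
      then have fin: "finite m" by (rule finite_of_subsets_card)
      \<comment> \<open>The error of a fit is the projected noise, inside the column space, minus
        the bias, orthogonal to it.\<close>
      have "(\<lambda>i. proj n Z m Y i - mu i) = (\<lambda>i. proj n Z m e i - proj_perp n Z m mu i)"
        by (simp add: Y_def proj_add[OF fin] proj_perp_def algebra_simps)
      then have "sqnorm n (\<lambda>i. proj n Z m Y i - mu i) = r m + d m"
        using inprod_proj_perp_proj[OF fin, of n Z mu e]
        by (simp add: sqnorm_diff r_def d_def inprod_commute)
      then show "sqnorm n (\<lambda>i. proj n Z m Y i - mu i) \<le> t + d m" using rt[OF m] by simp
    qed
    also have "\<dots> = t + (\<Sum>m\<in>?I. ?w m * d m)" unfolding distrib_left sum.distrib wc by simp
    finally show ?thesis using wd by simp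
  qed
  have "n = 0 \<Longrightarrow> ew_dispersion \<alpha> n p u Z Y = 0" by (simp add: ew_dispersion_def sqnorm_def)
  then have nV: "n * (ew_dispersion \<alpha> n p u Z Y / n) = ew_dispersion \<alpha> n p u Z Y" by auto
  have "\<bar>n * est \<alpha> n p u Z Y - T\<bar> \<le> 14 * t + 5 * q + 3 * A"
    using est
  proof (elim insertE emptyE)
    assume "est = sigma_hat_I"
    then have "n * est \<alpha> n p u Z Y = n * sigma_hat_II \<alpha> n p u Z Y - ew_dispersion \<alpha> n p u Z Y"
      using nV by (simp add: sigma_hat_I_eq[OF \<open>u \<le> p\<close>] right_diff_distrib)
    then show ?thesis using II V V0 t0 q0 A0 by linarith
  next
    assume "est = sigma_hat_II"
    then show ?thesis using II t0 q0 A0 by simp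
  next
    assume "est = sigma_hat_III"
    then have "n * est \<alpha> n p u Z Y = n * sigma_hat_II \<alpha> n p u Z Y + ew_dispersion \<alpha> n p u Z Y"
      using nV by (simp add: sigma_hat_III_eq[OF \<open>u \<le> p\<close>] distrib_left)
    then show ?thesis using II V V0 t0 q0 A0 by linarith
  qed
  then show ?thesis by (simp add: Y_def T_def A_def)
qed

lemma measurable_sigma_hat:
  assumes Z: "\<And>i j. (\<lambda>\<omega>. Z \<omega> i j) \<in> borel_measurable M"
    and Y: "\<And>i. (\<lambda>\<omega>. Y \<omega> i) \<in> borel_measurable M"
    and est: "est \<in> {sigma_hat_I, sigma_hat_II, sigma_hat_III}"
  shows "(\<lambda>\<omega>. est \<alpha> n p u (Z \<omega>) (Y \<omega>)) \<in> borel_measurable M"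
proof -
  have proj: "(\<lambda>\<omega>. proj n (Z \<omega>) m (Y \<omega>) i) \<in> borel_measurable M" if "m \<in> subsets_card p u" for m i
    using Z Y that by (intro measurable_proj finite_of_subsets_card)
  have perp: "(\<lambda>\<omega>. sqnorm n (proj_perp n (Z \<omega>) m (Y \<omega>))) \<in> borel_measurable M"
    if "m \<in> subsets_card p u" for m
    unfolding proj_perp_def using proj[OF that] Y
    by (intro measurable_sqnorm borel_measurable_diff)
  have w: "(\<lambda>\<omega>. ew_weight \<alpha> n p u (Z \<omega>) (Y \<omega>) m) \<in> borel_measurable M"
    if "m \<in> subsets_card p u" for m
    unfolding ew_weight_def using perp that
    by (intro borel_measurable_divide borel_measurable_sum borel_measurable_exp[THEN measurable_compose[rotated]]
        borel_measurable_uminus borel_measurable_const) auto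
  have h: "(\<lambda>\<omega>. mu_hat \<alpha> n p u (Z \<omega>) (Y \<omega>) i) \<in> borel_measurable M" for i
    unfolding mu_hat_def using proj w by (intro borel_measurable_sum borel_measurable_times) auto
  have "(\<lambda>\<omega>. sigma_hat_I \<alpha> n p u (Z \<omega>) (Y \<omega>)) \<in> borel_measurable M"
    unfolding sigma_hat_I_def using h
    by (intro borel_measurable_divide measurable_sqnorm borel_measurable_const)
  moreover have "(\<lambda>\<omega>. sigma_hat_II \<alpha> n p u (Z \<omega>) (Y \<omega>)) \<in> borel_measurable M"
    unfolding sigma_hat_II_def using w proj
    by (intro borel_measurable_divide borel_measurable_sum borel_measurable_times
        measurable_sqnorm borel_measurable_const) auto
  moreover have "(\<lambda>\<omega>. sigma_hat_III \<alpha> n p u (Z \<omega>) (Y \<omega>)) \<in> borel_measurable M"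
    unfolding sigma_hat_III_def using h Y
    by (intro borel_measurable_divide borel_measurable_diff measurable_sqnorm borel_measurable_const)
  ultimately show ?thesis using est by auto
qed

section \<open>Exponential moments of projected sub-Gaussian noise\<close>

lemma nn_integral_std_normal:
  assumes [measurable]: "f \<in> borel_measurable borel"
  shows "(\<integral>\<^sup>+g. f g \<partial>std_normal_distribution) = (\<integral>\<^sup>+g. ennreal (std_normal_density g) * f g \<partial>lborel)"
  by (subst nn_integral_density) auto

lemma nn_integral_normal_density:
  "\<sigma> > 0 \<Longrightarrow> (\<integral>\<^sup>+g. ennreal (normal_density \<mu> \<sigma> g) \<partial>lborel) = 1"
  by (subst nn_integral_eq_integral) auto

text \<open>Completing the square gives a shifted normal density. Read from right to left, the
  exponential of a square becomes a Gaussian mean of exponentials of a linear term.\<close>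

lemma std_normal_exp_linear:
  "(\<integral>\<^sup>+g. ennreal (exp (s * g)) \<partial>std_normal_distribution) = ennreal (exp (s\<^sup>2 / 2))"
proof -
  have "(\<integral>\<^sup>+g. ennreal (exp (s * g)) \<partial>std_normal_distribution) =
      (\<integral>\<^sup>+g. ennreal (exp (s\<^sup>2 / 2)) * ennreal (normal_density s 1 g) \<partial>lborel)"
  proof (subst nn_integral_std_normal, simp, rule nn_integral_cong)
    fix g :: real
    have "std_normal_density g * exp (s * g) = exp (s\<^sup>2 / 2) * normal_density s 1 g"
      by (simp add: normal_density_def exp_add[symmetric] power2_eq_square algebra_simps
          add_divide_distrib diff_divide_distrib)
    then show "ennreal (std_normal_density g) * ennreal (exp (s * g)) =
        ennreal (exp (s\<^sup>2 / 2)) * ennreal (normal_density s 1 g)"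
      by (simp add: ennreal_mult'[symmetric])
  qed
  also have "\<dots> = ennreal (exp (s\<^sup>2 / 2))"
    by (subst nn_integral_cmult) (auto simp: nn_integral_normal_density)
  finally show ?thesis .
qed

text \<open>The weight tilts the variance from 1 to 4, because 1/2 - 3/8 = 1/8, and the ratio of the
  normalising constants is 2. This is the origin of \<open>k * l = 3 / 8\<close> and of the factor 2
  per column.\<close>

lemma std_normal_exp_quadratic:
  "(\<integral>\<^sup>+g. ennreal (exp (3 / 8 * g\<^sup>2)) \<partial>std_normal_distribution) = 2"
proof -
  have "(\<integral>\<^sup>+g. ennreal (exp (3 / 8 * g\<^sup>2)) \<partial>std_normal_distribution) =
      (\<integral>\<^sup>+g. ennreal 2 * ennreal (normal_density 0 2 g) \<partial>lborel)"
  proof (subst nn_integral_std_normal, simp, rule nn_integral_cong)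
    fix g :: real
    have "std_normal_density g * exp (3 / 8 * g\<^sup>2) = 2 * normal_density 0 2 g"
      using real_sqrt_mult[of 4 2]
      by (simp add: normal_density_def real_sqrt_mult exp_add[symmetric])
    then show "ennreal (std_normal_density g) * ennreal (exp (3 / 8 * g\<^sup>2)) =
        ennreal 2 * ennreal (normal_density 0 2 g)"
      by (simp only: ennreal_mult'[symmetric] normal_density_nonneg exp_ge_zero)
  qed
  also have "\<dots> = 2"
    by (subst nn_integral_cmult) (auto simp: nn_integral_normal_density)
  finally show ?thesis .
qed

text \<open>
  The columns are removed one at a time. The square of the new coordinate in the exponent is
  linearised by an independent standard normal \<open>g\<close>, which turns the step into the same
  statement for the vector \<open>a\<close> shifted by a multiple of \<open>g\<close> in the new direction; hence
  the extra linear term in the claim.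
\<close>

lemma exp_moment_sqnorm_proj:
  fixes E :: "'b measure" and e :: "'b \<Rightarrow> nat \<Rightarrow> real"
  assumes "sigma_finite_measure E" and fin: "finite m"
    and e: "\<And>i. i < n \<Longrightarrow> (\<lambda>x. e x i) \<in> borel_measurable E"
    and mgf: "\<And>a. (\<integral>\<^sup>+x. exp (inprod n a (e x)) \<partial>E) \<le> ennreal (exp (k / 2 * sqnorm n a))"
    and k: "0 \<le> k" and l: "0 \<le> l" "k * l = 3 / 8"
    and orth: "\<And>j. j \<in> m \<Longrightarrow> inprod n a (\<lambda>i. Z i j) = 0"
  shows "(\<integral>\<^sup>+x. exp (l * sqnorm n (proj n Z m (e x)) + inprod n a (e x)) \<partial>E)
     \<le> ennreal (2 ^ card m * exp (k / 2 * sqnorm n a))"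
  using fin orth
proof (induction m arbitrary: a)
  case empty
  then show ?case using mgf[of a] by (simp add: proj_empty sqnorm_def)
next
  case (insert j m)
  interpret E: sigma_finite_measure E by fact
  interpret G: prob_space std_normal_distribution by (rule prob_space_normal_density) simp
  interpret pair_sigma_finite E std_normal_distribution by unfold_locales
  define r where "r = proj_perp n Z m (\<lambda>i. Z i j)"
  \<comment> \<open>Chosen so that \<open>(c * inprod n r v)\<^sup>2 / 2\<close> is the new term
    \<open>l * (inprod n v r)\<^sup>2 / sqnorm n r\<close>; both are \<open>0\<close> when the
    residual vanishes.\<close>
  define c where "c = sqrt (2 * l) / sqrt (sqnorm n r)"
  define b where "b g = (\<lambda>i. a i + (g * c) * r i)" for g
  have P [measurable]: "(\<lambda>x. sqnorm n (proj n Z m (e x))) \<in> borel_measurable E"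
    using e by (intro measurable_sqnorm measurable_proj insert.hyps) auto
  have L [measurable]: "(\<lambda>x. inprod n v (e x)) \<in> borel_measurable E" for v
    using e by (intro measurable_inprod) auto
  \<comment> \<open>Without a mixed term, the squared norm of \<open>b g\<close> grows purely
    quadratically in \<open>g\<close>, at a rate independent of \<open>a\<close>.\<close>
  have ar: "inprod n a r = 0"
  proof -
    have "inprod n a (proj n Z m (\<lambda>i. Z i j)) = 0"
      using insert by (intro inprod_colspace_eq_0[OF proj_in_colspace]) auto
    then show ?thesis using insert.prems[of j] by (simp add: r_def proj_perp_def inprod_diff_right)
  qed
  have b_lin: "inprod n (b g) v = inprod n a v + g * c * inprod n r v" for g v
    unfolding b_def inprod_add_left inprod_scale_left ..
  have b_orth: "inprod n (b g) (\<lambda>i. Z i i') = 0" if "i' \<in> m" for g i'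
    using insert.prems that proj_perp_orth_column[OF insert.hyps(1) that]
    by (simp add: b_lin r_def)
  have c2: "c\<^sup>2 * sqnorm n r \<le> 2 * l" using l by (simp add: c_def power_divide)
  have b_norm: "k / 2 * sqnorm n (b g) \<le> k / 2 * sqnorm n a + 3 / 8 * g\<^sup>2" for g
  proof -
    have "sqnorm n (b g) = sqnorm n a + g\<^sup>2 * (c\<^sup>2 * sqnorm n r)"
      unfolding b_def sqnorm_add sqnorm_scale inprod_scale_right ar by (simp add: power_mult_distrib)
    also have "\<dots> \<le> sqnorm n a + g\<^sup>2 * (2 * l)"
      using c2 by (intro add_left_mono mult_left_mono) auto
    finally have "k / 2 * sqnorm n (b g) \<le> k / 2 * (sqnorm n a + g\<^sup>2 * (2 * l))"
      using k by (intro mult_left_mono) auto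
    also have "\<dots> = k / 2 * sqnorm n a + (k * l) * g\<^sup>2" by (simp add: algebra_simps)
    finally show ?thesis by (simp add: l)
  qed
  have step: "ennreal (exp (l * sqnorm n (proj n Z (insert j m) v) + inprod n a v)) =
      (\<integral>\<^sup>+g. exp (l * sqnorm n (proj n Z m v) + inprod n (b g) v) \<partial>std_normal_distribution)" for v
  proof -
    have "(c * inprod n r v)\<^sup>2 / 2 = l * ((inprod n v r)\<^sup>2 / sqnorm n r)"
      using l by (simp add: c_def power_mult_distrib power_divide inprod_commute)
    then have "ennreal (exp (l * sqnorm n (proj n Z (insert j m) v) + inprod n a v)) =
        ennreal (exp (l * sqnorm n (proj n Z m v) + inprod n a v)) * ennreal (exp ((c * inprod n r v)\<^sup>2 / 2))"
      by (simp add: sqnorm_proj_insert[OF insert.hyps(1)] r_def[symmetric] ennreal_mult'[symmetric]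
          exp_add[symmetric] algebra_simps)
    also have "\<dots> = (\<integral>\<^sup>+g. ennreal (exp (l * sqnorm n (proj n Z m v) + inprod n a v)) *
        ennreal (exp ((c * inprod n r v) * g)) \<partial>std_normal_distribution)"
      by (subst nn_integral_cmult) (auto simp: std_normal_exp_linear)
    also have "\<dots> = (\<integral>\<^sup>+g. exp (l * sqnorm n (proj n Z m v) + inprod n (b g) v) \<partial>std_normal_distribution)"
      by (simp add: b_lin ennreal_mult'[symmetric] exp_add[symmetric] algebra_simps)
    finally show ?thesis .
  qed
  have "(\<integral>\<^sup>+x. exp (l * sqnorm n (proj n Z (insert j m) (e x)) + inprod n a (e x)) \<partial>E) =
    (\<integral>\<^sup>+x. \<integral>\<^sup>+g. exp (l * sqnorm n (proj n Z m (e x)) + inprod n (b g) (e x)) \<partial>std_normal_distribution \<partial>E)"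
    unfolding step ..
  \<comment> \<open>Tonelli: with \<open>g\<close> fixed, the induction hypothesis applies to
    \<open>b g\<close>, which is still orthogonal to the columns in \<open>m\<close>.\<close>
  also have "\<dots> = (\<integral>\<^sup>+g. \<integral>\<^sup>+x. exp (l * sqnorm n (proj n Z m (e x)) + inprod n (b g) (e x)) \<partial>E \<partial>std_normal_distribution)"
    unfolding b_lin by (intro Fubini'[symmetric]) measurable
  also have "\<dots> \<le> (\<integral>\<^sup>+g. ennreal (2 ^ card m * exp (k / 2 * sqnorm n a)) * ennreal (exp (3 / 8 * g\<^sup>2)) \<partial>std_normal_distribution)"
  proof (rule nn_integral_mono)
    fix g
    have "(\<integral>\<^sup>+x. exp (l * sqnorm n (proj n Z m (e x)) + inprod n (b g) (e x)) \<partial>E)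
      \<le> ennreal (2 ^ card m * exp (k / 2 * sqnorm n (b g)))"
      by (rule insert.IH) (rule b_orth)
    also have "\<dots> \<le> ennreal (2 ^ card m * exp (k / 2 * sqnorm n a + 3 / 8 * g\<^sup>2))"
      using b_norm[of g] by (intro ennreal_leI mult_left_mono) auto
    finally show "(\<integral>\<^sup>+x. exp (l * sqnorm n (proj n Z m (e x)) + inprod n (b g) (e x)) \<partial>E)
      \<le> ennreal (2 ^ card m * exp (k / 2 * sqnorm n a)) * ennreal (exp (3 / 8 * g\<^sup>2))"
      by (simp add: ennreal_mult'[symmetric] exp_add mult.assoc)
  qed
  also have "\<dots> = ennreal (2 ^ card m * exp (k / 2 * sqnorm n a)) * 2"
    by (subst nn_integral_cmult) (auto simp only: std_normal_exp_quadratic, measurable)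
  also have "\<dots> = ennreal (2 ^ card (insert j m) * exp (k / 2 * sqnorm n a))"
    using insert.hyps ennreal_mult'[of "2 ^ card m * exp (k / 2 * sqnorm n a)" 2] by (simp add: mult_ac)
  finally show ?case .
qed

text \<open>Independence factorises the moment generating function. The proxy \<open>k\<close> may
  exceed \<open>K\<^sup>2\<close> because \<open>K\<close> can be \<open>0\<close>, whereas
  \<open>k * l = 3 / 8\<close> forces a nonzero \<open>k\<close>.\<close>

lemma subgaussian_PiM_mgf:
  fixes D :: "real measure"
  assumes D: "real_distribution D" and sg: "subgaussian D K" and k: "K\<^sup>2 \<le> k"
  shows "(\<integral>\<^sup>+x. exp (inprod n a x) \<partial>(\<Pi>\<^sub>M i\<in>{..<n}. D)) \<le> ennreal (exp (k / 2 * sqnorm n a))"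
proof -
  interpret D: real_distribution D by fact
  interpret product_sigma_finite "\<lambda>_::nat. D" by unfold_locales
  have "(\<integral>\<^sup>+x. exp (inprod n a x) \<partial>(\<Pi>\<^sub>M i\<in>{..<n}. D)) =
      (\<integral>\<^sup>+x. (\<Prod>i<n. ennreal (exp (a i * x i))) \<partial>(\<Pi>\<^sub>M i\<in>{..<n}. D))"
    by (simp add: inprod_def exp_sum prod_ennreal)
  also have "\<dots> = (\<Prod>i<n. \<integral>\<^sup>+x. ennreal (exp (a i * x)) \<partial>D)"
    by (rule product_nn_integral_prod) auto
  also have "\<dots> = ennreal (\<Prod>i<n. \<integral>x. exp (a i * x) \<partial>D)"
    using sg by (subst nn_integral_eq_integral) (auto simp: subgaussian_def prod_ennreal)
  also have "\<dots> \<le> ennreal (\<Prod>i<n. exp (k / 2 * (a i)\<^sup>2))"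
  proof (intro ennreal_leI prod_mono conjI)
    fix i
    have "(\<integral>x. exp (a i * x) \<partial>D) \<le> exp (K\<^sup>2 * (a i)\<^sup>2 / 2)"
      using sg by (auto simp: subgaussian_def)
    also have "\<dots> \<le> exp (k / 2 * (a i)\<^sup>2)"
      using k by (simp add: mult_right_mono)
    finally show "(\<integral>x. exp (a i * x) \<partial>D) \<le> exp (k / 2 * (a i)\<^sup>2)" .
  qed simp
  also have "\<dots> = ennreal (exp (k / 2 * sqnorm n a))"
    by (simp add: exp_sum[symmetric] sqnorm_def sum_distrib_left)
  finally show ?thesis .
qed

section \<open>Characteristic functions\<close>

lemma norm_iexp_diff_le: "norm (iexp x - iexp y) \<le> \<bar>x - y\<bar>"
proof -
  have "iexp x - iexp y = iexp y * (iexp (x - y) - 1)"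
    by (simp add: right_diff_distrib exp_diff)
  also have "norm \<dots> = norm (iexp (x - y) - 1)" by (simp add: norm_mult)
  also have "\<dots> \<le> \<bar>x - y\<bar>" using iexp_approx1[of "x - y" 0] by simp
  finally show ?thesis .
qed

text \<open>The exponentials differ by at most 2 where the variables differ by more than
  \<open>d\<close>, and elsewhere by at most \<open>\<bar>t\<bar> * d\<close>. Characteristic
  functions are the form in which the continuity theorem takes the limit.\<close>

lemma (in prob_space) slutsky_char:
  fixes X Y :: "nat \<Rightarrow> 'a \<Rightarrow> real"
  assumes [measurable]: "\<And>n. X n \<in> borel_measurable M" "\<And>n. Y n \<in> borel_measurable M"
    and diff: "tendsto_prob_zero M (\<lambda>n \<omega>. Y n \<omega> - X n \<omega>)"
    and X: "(\<lambda>n. char (distr M borel (X n)) t) \<longlonglongrightarrow> L"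
  shows "(\<lambda>n. char (distr M borel (Y n)) t) \<longlonglongrightarrow> L"
proof -
  let ?P = "\<lambda>d n. prob {\<omega>\<in>space M. \<bar>Y n \<omega> - X n \<omega>\<bar> > d}"
  have bound: "norm (char (distr M borel (Y n)) t - char (distr M borel (X n)) t) \<le> \<bar>t\<bar> * d + 2 * ?P d n"
    if "d > 0" for n d
  proof -
    let ?A = "{\<omega>\<in>space M. \<bar>Y n \<omega> - X n \<omega>\<bar> > d}"
    have [measurable]: "?A \<in> events" by measurable
    have int: "integrable M (\<lambda>\<omega>. iexp (t * Y n \<omega>))" "integrable M (\<lambda>\<omega>. iexp (t * X n \<omega>))"
      by (auto intro!: integrable_iexp)
    have "norm (char (distr M borel (Y n)) t - char (distr M borel (X n)) t) =
        norm (\<integral>\<omega>. iexp (t * Y n \<omega>) - iexp (t * X n \<omega>) \<partial>M)"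
      unfolding char_def using int by (simp add: integral_distr)
    also have "\<dots> \<le> (\<integral>\<omega>. norm (iexp (t * Y n \<omega>) - iexp (t * X n \<omega>)) \<partial>M)"
      by (rule integral_norm_bound)
    also have "\<dots> \<le> (\<integral>\<omega>. \<bar>t\<bar> * d + 2 * indicator ?A \<omega> \<partial>M)"
    proof (rule integral_mono)
      show "integrable M (\<lambda>\<omega>. norm (iexp (t * Y n \<omega>) - iexp (t * X n \<omega>)))"
        using int by (intro integrable_norm Bochner_Integration.integrable_diff)
      show "integrable M (\<lambda>\<omega>. \<bar>t\<bar> * d + 2 * indicator ?A \<omega>)"
        by (intro Bochner_Integration.integrable_add integrable_const integrable_mult_right
            integrable_real_indicator) (auto simp: emeasure_eq_measure)
      fix \<omega> assume \<omega>: "\<omega> \<in> space M"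
      show "norm (iexp (t * Y n \<omega>) - iexp (t * X n \<omega>)) \<le> \<bar>t\<bar> * d + 2 * indicator ?A \<omega>"
      proof (cases "\<omega> \<in> ?A")
        case True
        have "norm (iexp (t * Y n \<omega>) - iexp (t * X n \<omega>)) \<le> norm (iexp (t * Y n \<omega>)) + norm (iexp (t * X n \<omega>))"
          by (rule norm_triangle_ineq4)
        also have "\<dots> = 2" by (simp del: of_real_mult)
        also have "2 \<le> \<bar>t\<bar> * d + 2" using that by simp
        finally show ?thesis using True by simp
      next
        case False
        have "norm (iexp (t * Y n \<omega>) - iexp (t * X n \<omega>)) \<le> \<bar>t\<bar> * \<bar>Y n \<omega> - X n \<omega>\<bar>"
          using norm_iexp_diff_le[of "t * Y n \<omega>" "t * X n \<omega>"]
          by (simp add: abs_mult[symmetric] algebra_simps)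
        also have "\<dots> \<le> \<bar>t\<bar> * d" using False \<omega> by (intro mult_left_mono) auto
        finally show ?thesis using False by simp
      qed
    qed
    also have "\<dots> = \<bar>t\<bar> * d + 2 * ?P d n"
      by (subst Bochner_Integration.integral_add)
        (auto simp: emeasure_eq_measure prob_space intro!: integrable_real_indicator)
    finally show ?thesis .
  qed
  have "(\<lambda>n. char (distr M borel (Y n)) t - char (distr M borel (X n)) t) \<longlonglongrightarrow> 0"
  proof (rule LIMSEQ_I)
    fix r :: real assume r: "r > 0"
    \<comment> \<open>The summand 1 covers \<open>t = 0\<close>; each of the two error terms gets
      half of \<open>r\<close>.\<close>
    define d where "d = r / (2 * (\<bar>t\<bar> + 1))"
    have d: "d > 0" using r by (simp add: d_def add_nonneg_pos)
    have "\<bar>t\<bar> * d \<le> (\<bar>t\<bar> + 1) * d" using d by simp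
    also have "\<dots> = r / 2"
      using add_nonneg_pos[OF abs_ge_zero[of t] zero_less_one] by (simp add: d_def field_simps)
    finally have td: "\<bar>t\<bar> * d \<le> r / 2" .
    have "?P d \<longlonglongrightarrow> 0" using diff d by (auto simp: tendsto_prob_zero_def)
    then have "eventually (\<lambda>n. ?P d n < r / 4) sequentially"
      using r by (intro order_tendstoD(2)[of _ 0]) auto
    then obtain N where N: "\<And>n. n \<ge> N \<Longrightarrow> ?P d n < r / 4" by (auto simp: eventually_sequentially)
    have "norm (char (distr M borel (Y n)) t - char (distr M borel (X n)) t - 0) < r" if "n \<ge> N" for n
      using bound[OF d, of n] td N[OF that] by (simp only: diff_0_right)
    then show "\<exists>N. \<forall>n\<ge>N. norm (char (distr M borel (Y n)) t - char (distr M borel (X n)) t - 0) < r"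
      by blast
  qed
  from tendsto_add[OF this X] show ?thesis by simp
qed

text \<open>
  The rows of a triangular array need not come from one sequence, as
  \<open>central_limit_theorem\<close> requires; only the characteristic function of a row sum is at hand.
\<close>

lemma (in real_distribution) char_power_tendsto:
  assumes "integrable M (\<lambda>x. x)" "expectation (\<lambda>x. x) = 0"
    and int2: "integrable M (\<lambda>x. x\<^sup>2)" and v: "expectation (\<lambda>x. x\<^sup>2) = v"
  shows "(\<lambda>n. char M (t / sqrt n) ^ n) \<longlonglongrightarrow> complex_of_real (exp (- (v * t\<^sup>2) / 2))"
proof -
  let ?R = "\<lambda>n::nat. LINT x|M. min (6 * x\<^sup>2) (\<bar>t / sqrt n\<bar> * \<bar>x\<bar> ^ 3)"
  have main: "\<forall>\<^sub>F n in sequentially.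
      norm (char M (t / sqrt n) ^ n - complex_of_real (1 + (- (v * t\<^sup>2) / 2) / n) ^ n) \<le> t\<^sup>2 / 6 * ?R n"
  proof (rule eventually_sequentiallyI)
    fix n :: nat
    \<comment> \<open>Beyond this threshold \<open>1 - v * t\<^sup>2 / (2 * n)\<close> lies between
      -1 and 1, as the comparison of powers requires.\<close>
    assume "n \<ge> Suc (nat (ceiling (v * t\<^sup>2 / 4)))"
    then have n: "n > 0" "n \<ge> v * t\<^sup>2 / 4" by linarith+
    have v0: "v \<ge> 0" unfolding v[symmetric] by simp
    let ?s = "t / sqrt n"
    have "norm (char M ?s - (1 - ?s\<^sup>2 * v / 2)) \<le> ?s\<^sup>2 / 6 * (LINT x|M. min (6 * x\<^sup>2) (\<bar>?s\<bar> * \<bar>x\<bar> ^ 3))"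
      using assms by (intro char_approx3) auto
    also have "1 - ?s\<^sup>2 * v / 2 = 1 + (- (v * t\<^sup>2) / 2) / n"
      using n by (simp add: power_divide field_simps)
    finally have 1: "norm (char M ?s - complex_of_real (1 + (- (v * t\<^sup>2) / 2) / n)) \<le> ?s\<^sup>2 / 6 * ?R n"
      by simp
    have "norm (char M ?s ^ n - complex_of_real (1 + (- (v * t\<^sup>2) / 2) / n) ^ n) \<le>
        n * norm (char M ?s - complex_of_real (1 + (- (v * t\<^sup>2) / 2) / n))"
    proof (rule norm_power_diff)
      show "norm (char M ?s) \<le> 1" by (rule cmod_char_le_1)
      have "0 \<le> v * t\<^sup>2 / 2 / n" "v * t\<^sup>2 / 2 / n \<le> 2"
        using n v0 by (auto simp: divide_le_eq)
      then show "norm (complex_of_real (1 + (- (v * t\<^sup>2) / 2) / n)) \<le> 1"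
        unfolding norm_of_real by (simp add: abs_le_iff)
    qed
    also have "\<dots> \<le> n * (?s\<^sup>2 / 6 * ?R n)"
      by (intro mult_left_mono 1) simp
    also have "\<dots> = t\<^sup>2 / 6 * ?R n" using n by (simp add: power_divide)
    finally show "norm (char M (t / sqrt n) ^ n - complex_of_real (1 + (- (v * t\<^sup>2) / 2) / n) ^ n) \<le> t\<^sup>2 / 6 * ?R n" .
  qed
  \<comment> \<open>Pointwise limit for dominated convergence; the truncation at
    \<open>6 * x\<^sup>2\<close> provides the integrable majorant.\<close>
  have "(\<lambda>n. min (6 * x\<^sup>2) (\<bar>t / sqrt (real n)\<bar> * \<bar>x\<bar> ^ 3)) \<longlonglongrightarrow> 0" for x
  proof -
    have "(\<lambda>n. t / sqrt (real n)) \<longlonglongrightarrow> 0"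
      by (intro tendsto_divide_0[OF tendsto_const] filterlim_at_top_imp_at_infinity
          sqrt_at_top[THEN filterlim_compose] filterlim_real_sequentially)
    from tendsto_mult_left_zero[OF tendsto_rabs_zero[OF this]]
    have "(\<lambda>n. \<bar>t / sqrt (real n)\<bar> * \<bar>x\<bar> ^ 3) \<longlonglongrightarrow> 0" .
    from tendsto_min[OF tendsto_const this, of "6 * x\<^sup>2"] show ?thesis by (simp add: min_absorb2)
  qed
  then have "?R \<longlonglongrightarrow> (LINT x|M. 0)"
    using int2 by (intro integral_dominated_convergence[where w = "\<lambda>x. 6 * x\<^sup>2"]) auto
  then have R0: "(\<lambda>n. t\<^sup>2 / 6 * ?R n) \<longlonglongrightarrow> 0"
    by (simp only: integral_zero tendsto_mult_right_zero)
  have "(\<lambda>n. complex_of_real ((1 + (- (v * t\<^sup>2) / 2) / n) ^ n)) \<longlonglongrightarrow> complex_of_real (exp (- (v * t\<^sup>2) / 2))"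
    by (rule isCont_tendsto_compose[OF _ tendsto_exp_limit_sequentially]) auto
  then show ?thesis
    by (rule Lim_transform) (use Lim_null_comparison[OF main R0] in simp)
qed

section \<open>The normal limit law\<close>

lemma real_distribution_normal_measure: "v \<ge> 0 \<Longrightarrow> real_distribution (normal_measure v)"
  unfolding normal_measure_def real_distribution_def real_distribution_axioms_def
  using prob_space_normal_density[of "sqrt v" 0] prob_space_return[of 0 borel] by auto

text \<open>A centred normal law is a scaled standard one. The point mass at \<open>v = 0\<close>
  does occur as a limit, for instance when the signal takes the values 1 and -1 with equal
  probability and the noise vanishes.\<close>

lemma char_normal_measure:
  assumes "v \<ge> 0"
  shows "char (normal_measure v) t = complex_of_real (exp (- (v * t\<^sup>2) / 2))"
proof (cases "v = 0")
  case True
  then show ?thesis unfolding char_def normal_measure_def by (simp add: integral_return)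
next
  case False
  interpret N: prob_space std_normal_distribution by (rule prob_space_normal_density) simp
  have "distributed std_normal_distribution lborel (\<lambda>x. x) std_normal_density"
    by (auto simp: distributed_def distr_id2)
  then have "distributed std_normal_distribution lborel (\<lambda>x. 0 + sqrt v * x)
      (normal_density (0 + sqrt v * 0) (\<bar>sqrt v\<bar> * 1))"
    using False assms by (intro N.normal_density_affine) auto
  then have "distr std_normal_distribution lborel (\<lambda>x. sqrt v * x) = density lborel (normal_density 0 (sqrt v))"
    using assms by (simp add: distributed_def)
  then have "normal_measure v = distr std_normal_distribution borel (\<lambda>x. sqrt v * x)"
    using False by (simp add: normal_measure_def cong: distr_cong)
  then have "char (normal_measure v) t = char std_normal_distribution (sqrt v * t)"
    unfolding char_def by (simp add: integral_distr mult_ac)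
  then show ?thesis using assms by (simp add: char_std_normal_distribution power_mult_distrib)
qed

text \<open>The two vectors are integrated one after the other, and each integral factorises over
  the coordinates. This avoids regrouping a pair of product measures into a product of pairs; the
  bound by 1 supplies integrability.\<close>

lemma integral_prod_pair_PiM:
  fixes f :: "real \<Rightarrow> real \<Rightarrow> complex"
  assumes D1: "real_distribution D1" and D2: "real_distribution D2"
    and [measurable]: "(\<lambda>z. f (fst z) (snd z)) \<in> borel_measurable (borel \<Otimes>\<^sub>M borel)"
    and bdd: "\<And>x y. norm (f x y) \<le> 1"
  shows "(\<integral>z. (\<Prod>i<n. f (fst z i) (snd z i)) \<partial>((\<Pi>\<^sub>M i\<in>{..<n}. D1) \<Otimes>\<^sub>M (\<Pi>\<^sub>M i\<in>{..<n}. D2))) =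
    (\<integral>z. f (fst z) (snd z) \<partial>(D1 \<Otimes>\<^sub>M D2)) ^ n"
proof -
  interpret D1: real_distribution D1 by fact
  interpret D2: real_distribution D2 by fact
  interpret P1: product_prob_space "\<lambda>_. D1" "{..<n}" by unfold_locales
  interpret P2: product_prob_space "\<lambda>_. D2" "{..<n}" by unfold_locales
  interpret P: pair_prob_space "\<Pi>\<^sub>M i\<in>{..<n}. D1" "\<Pi>\<^sub>M i\<in>{..<n}. D2" by unfold_locales
  interpret Q: pair_prob_space D1 D2 by unfold_locales
  have [measurable]: "(\<lambda>y. f x y) \<in> borel_measurable borel" for x
    using measurable_compose[of "\<lambda>y. (x, y)" borel "borel \<Otimes>\<^sub>M borel" "\<lambda>z. f (fst z) (snd z)" borel] by simp
  have prod_bdd: "norm (\<Prod>i<n. f (a i) (b i)) \<le> 1" for a b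
    unfolding prod_norm[symmetric] using bdd by (intro prod_le_1) auto
  have m1: "(\<lambda>z. f (fst z) (snd z)) \<in> borel_measurable (D1 \<Otimes>\<^sub>M D2)" by measurable
  have m2: "(\<lambda>z. \<Prod>i<n. f (fst z i) (snd z i)) \<in>
      borel_measurable ((\<Pi>\<^sub>M i\<in>{..<n}. D1) \<Otimes>\<^sub>M (\<Pi>\<^sub>M i\<in>{..<n}. D2))"
  proof (rule borel_measurable_prod)
    fix i assume i: "i \<in> {..<n}"
    have "(\<lambda>z. (fst z i, snd z i)) \<in> ((\<Pi>\<^sub>M i\<in>{..<n}. D1) \<Otimes>\<^sub>M (\<Pi>\<^sub>M i\<in>{..<n}. D2)) \<rightarrow>\<^sub>M (D1 \<Otimes>\<^sub>M D2)"
      by (intro measurable_Pair measurable_compose[OF measurable_fst measurable_component_singleton[OF i]]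
          measurable_compose[OF measurable_snd measurable_component_singleton[OF i]])
    from measurable_compose[OF this m1]
    show "(\<lambda>z. f (fst z i) (snd z i)) \<in> borel_measurable ((\<Pi>\<^sub>M i\<in>{..<n}. D1) \<Otimes>\<^sub>M (\<Pi>\<^sub>M i\<in>{..<n}. D2))"
      by simp
  qed
  have F: "integrable D2 (f x)" for x
    using bdd by (intro D2.integrable_const_bound[where B=1]) auto
  have iQ: "integrable (D1 \<Otimes>\<^sub>M D2) (\<lambda>z. f (fst z) (snd z))"
    using bdd m1 by (intro Q.integrable_const_bound[where B=1]) auto
  have iP: "integrable ((\<Pi>\<^sub>M i\<in>{..<n}. D1) \<Otimes>\<^sub>M (\<Pi>\<^sub>M i\<in>{..<n}. D2)) (\<lambda>z. \<Prod>i<n. f (fst z i) (snd z i))"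
    using prod_bdd m2 by (intro P.integrable_const_bound[where B=1]) auto
  have "(\<integral>z. (\<Prod>i<n. f (fst z i) (snd z i)) \<partial>((\<Pi>\<^sub>M i\<in>{..<n}. D1) \<Otimes>\<^sub>M (\<Pi>\<^sub>M i\<in>{..<n}. D2))) =
    (\<integral>a. \<integral>b. (\<Prod>i<n. f (a i) (b i)) \<partial>(\<Pi>\<^sub>M i\<in>{..<n}. D2) \<partial>(\<Pi>\<^sub>M i\<in>{..<n}. D1))"
    using P.integral_fst'[OF iP] by simp
  also have "\<dots> = (\<integral>a. (\<Prod>i<n. \<integral>y. f (a i) y \<partial>D2) \<partial>(\<Pi>\<^sub>M i\<in>{..<n}. D1))"
    using F by (subst P2.product_integral_prod) auto
  also have "\<dots> = (\<Prod>i<n. \<integral>x. \<integral>y. f x y \<partial>D2 \<partial>D1)"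
    using Q.integrable_fst'[OF iQ] by (subst P1.product_integral_prod) auto
  also have "(\<integral>x. \<integral>y. f x y \<partial>D2 \<partial>D1) = (\<integral>z. f (fst z) (snd z) \<partial>(D1 \<Otimes>\<^sub>M D2))"
    using Q.integral_fst'[OF iQ] by simp
  finally show ?thesis by simp
qed

section \<open>Independence and moments\<close>

text \<open>
  The library predicate \<open>indep_var\<close> only covers two variables of the same type, hence the
  formulation through the joint law.
\<close>

lemma (in prob_space) indep_set_imp_joint_law:
  assumes ind: "indep_set (sigma_sets (space M) A) (sigma_sets (space M) B)"
    and A: "A \<subseteq> Pow (space M)" and B: "B \<subseteq> Pow (space M)"
    and X: "X \<in> measurable (sigma (space M) A) S" and Y: "Y \<in> measurable (sigma (space M) B) T"
  shows "random_variable S X" "random_variable T Y"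
    and "distr M (S \<Otimes>\<^sub>M T) (\<lambda>\<omega>. (X \<omega>, Y \<omega>)) = distr M S X \<Otimes>\<^sub>M distr M T Y"
proof -
  have sub: "sigma_sets (space M) A \<subseteq> events" "sigma_sets (space M) B \<subseteq> events"
    using ind by (auto simp: indep_set_def indep_sets_def UNIV_bool)
  have XA: "X -` C \<inter> space M \<in> sigma_sets (space M) A" if "C \<in> sets S" for C
    using measurable_sets[OF X that] A by (simp add: sets_measure_of space_measure_of)
  have YB: "Y -` C \<inter> space M \<in> sigma_sets (space M) B" if "C \<in> sets T" for C
    using measurable_sets[OF Y that] B by (simp add: sets_measure_of space_measure_of)
  show rX [measurable]: "random_variable S X"
    using measurable_space[OF X] A XA sub by (intro measurableI) (auto simp: space_measure_of)
  show rY [measurable]: "random_variable T Y"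
    using measurable_space[OF Y] B YB sub by (intro measurableI) (auto simp: space_measure_of)
  interpret X: prob_space "distr M S X" by (rule prob_space_distr) fact
  interpret Y: prob_space "distr M T Y" by (rule prob_space_distr) fact
  have "distr M S X \<Otimes>\<^sub>M distr M T Y = distr M (S \<Otimes>\<^sub>M T) (\<lambda>\<omega>. (X \<omega>, Y \<omega>))"
  proof (rule pair_measure_eqI)
    show "sigma_finite_measure (distr M S X)" "sigma_finite_measure (distr M T Y)" by unfold_locales
    show "sets (distr M S X \<Otimes>\<^sub>M distr M T Y) = sets (distr M (S \<Otimes>\<^sub>M T) (\<lambda>\<omega>. (X \<omega>, Y \<omega>)))"
      by (simp cong: sets_pair_measure_cong)
    fix C D assume "C \<in> sets (distr M S X)" "D \<in> sets (distr M T Y)"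
    then have C: "C \<in> sets S" and D: "D \<in> sets T" by auto
    have "prob ((X -` C \<inter> space M) \<inter> (Y -` D \<inter> space M)) = prob (X -` C \<inter> space M) * prob (Y -` D \<inter> space M)"
      using ind XA[OF C] YB[OF D] by (rule indep_setD)
    moreover have "(\<lambda>\<omega>. (X \<omega>, Y \<omega>)) -` (C \<times> D) \<inter> space M = (X -` C \<inter> space M) \<inter> (Y -` D \<inter> space M)"
      by auto
    ultimately show "emeasure (distr M S X) C * emeasure (distr M T Y) D =
        emeasure (distr M (S \<Otimes>\<^sub>M T) (\<lambda>\<omega>. (X \<omega>, Y \<omega>))) (C \<times> D)"
      using C D by (simp add: emeasure_distr emeasure_eq_measure ennreal_mult')
  qed
  then show "distr M (S \<Otimes>\<^sub>M T) (\<lambda>\<omega>. (X \<omega>, Y \<omega>)) = distr M S X \<Otimes>\<^sub>M distr M T Y" ..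
qed

text \<open>The product form of the joint law lets Tonelli freeze the design: for each value
  \<open>y\<close> of \<open>W\<close> the inner integral concerns the deterministic matrix
  \<open>Zf y\<close>, with linear part \<open>0\<close>. \<open>W\<close> is abstract so that it
  can hold signal and design together.\<close>

lemma (in prob_space) exp_moment_random_design:
  fixes e :: "'a \<Rightarrow> nat \<Rightarrow> real" and Zf :: "'c \<Rightarrow> nat \<Rightarrow> nat \<Rightarrow> real"
  assumes e: "\<And>i. i < n \<Longrightarrow> random_variable borel (\<lambda>\<omega>. e \<omega> i)" and W: "random_variable T W"
    and joint: "distr M ((\<Pi>\<^sub>M i\<in>{..<n}. borel) \<Otimes>\<^sub>M T) (\<lambda>\<omega>. (\<lambda>i\<in>{..<n}. e \<omega> i, W \<omega>)) =
      (\<Pi>\<^sub>M i\<in>{..<n}. D) \<Otimes>\<^sub>M distr M T W"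
    and D: "real_distribution D" "subgaussian D K"
    and k: "K\<^sup>2 \<le> k" "0 \<le> l" "k * l = 3 / 8"
    and m: "finite m" and Zf: "\<And>i j. i < n \<Longrightarrow> j \<in> m \<Longrightarrow> (\<lambda>y. Zf y i j) \<in> borel_measurable T"
  shows "(\<integral>\<^sup>+\<omega>. exp (l * sqnorm n (proj n (Zf (W \<omega>)) m (e \<omega>))) \<partial>M) \<le> ennreal (2 ^ card m)"
proof -
  let ?S = "\<Pi>\<^sub>M i\<in>{..<n}. borel :: real measure" and ?X = "\<lambda>\<omega>. \<lambda>i\<in>{..<n}. e \<omega> i"
  interpret D: real_distribution D by fact
  interpret P: product_prob_space "\<lambda>_. D" "{..<n}" by unfold_locales
  have X: "random_variable ?S ?X" using e by (intro measurable_restrict) auto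
  interpret TW: prob_space "distr M T W" by (rule prob_space_distr) fact
  interpret PT: pair_sigma_finite "\<Pi>\<^sub>M i\<in>{..<n}. D" "distr M T W" by unfold_locales
  define f where "f z = ennreal (exp (l * sqnorm n (proj n (Zf (snd z)) m (fst z))))" for z
  have coord: "(\<lambda>z. fst z i) \<in> borel_measurable (?S \<Otimes>\<^sub>M T)" if "i < n" for i
    using that by (intro measurable_compose[OF measurable_fst measurable_component_singleton]) auto
  have "(\<lambda>z. sqnorm n (proj n (Zf (snd z)) m (fst z))) \<in> borel_measurable (?S \<Otimes>\<^sub>M T)"
    using coord m Zf by (intro measurable_sqnorm measurable_proj measurable_compose[OF measurable_snd]) auto
  then have f: "f \<in> borel_measurable (?S \<Otimes>\<^sub>M T)" unfolding f_def by measurable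
  have sets_eq: "sets (?S \<Otimes>\<^sub>M T) = sets ((\<Pi>\<^sub>M i\<in>{..<n}. D) \<Otimes>\<^sub>M distr M T W)"
    by (intro sets_pair_measure_cong sets_PiM_cong) auto
  have "(\<integral>\<^sup>+\<omega>. exp (l * sqnorm n (proj n (Zf (W \<omega>)) m (e \<omega>))) \<partial>M) = (\<integral>\<^sup>+\<omega>. f (?X \<omega>, W \<omega>) \<partial>M)"
  proof (rule nn_integral_cong)
    fix \<omega>
    have "proj n (Zf (W \<omega>)) m (e \<omega>) = proj n (Zf (W \<omega>)) m (?X \<omega>)"
      by (rule proj_cong) auto
    then show "ennreal (exp (l * sqnorm n (proj n (Zf (W \<omega>)) m (e \<omega>)))) = f (?X \<omega>, W \<omega>)"
      by (simp add: f_def)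
  qed
  also have "\<dots> = (\<integral>\<^sup>+z. f z \<partial>distr M (?S \<Otimes>\<^sub>M T) (\<lambda>\<omega>. (?X \<omega>, W \<omega>)))"
    using f X W by (intro nn_integral_distr[symmetric]) auto
  also have "\<dots> = (\<integral>\<^sup>+y. \<integral>\<^sup>+x. f (x, y) \<partial>(\<Pi>\<^sub>M i\<in>{..<n}. D) \<partial>distr M T W)"
    unfolding joint using f measurable_cong_sets[OF sets_eq refl]
    by (intro PT.nn_integral_snd[symmetric]) auto
  also have "\<dots> \<le> (\<integral>\<^sup>+y. ennreal (2 ^ card m) \<partial>distr M T W)"
  proof (rule nn_integral_mono)
    fix y
    have "(\<integral>\<^sup>+x. exp (l * sqnorm n (proj n (Zf y) m x) + inprod n (\<lambda>_. 0) x) \<partial>(\<Pi>\<^sub>M i\<in>{..<n}. D))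
       \<le> ennreal (2 ^ card m * exp (k / 2 * sqnorm n (\<lambda>_. 0)))"
    proof (rule exp_moment_sqnorm_proj)
      show "sigma_finite_measure (\<Pi>\<^sub>M i\<in>{..<n}. D)" by unfold_locales
      show "(\<lambda>x. x i) \<in> borel_measurable (\<Pi>\<^sub>M i\<in>{..<n}. D)" if "i < n" for i
        using that measurable_component_singleton[of i "{..<n}" "\<lambda>_. D"] by simp
      show "(\<integral>\<^sup>+x. exp (inprod n a x) \<partial>(\<Pi>\<^sub>M i\<in>{..<n}. D)) \<le> ennreal (exp (k / 2 * sqnorm n a))" for a
        using D k by (intro subgaussian_PiM_mgf)
      show "0 \<le> k" using k(1) zero_le_power2[of K] by linarith
    qed (use m k in \<open>auto simp: inprod_def\<close>)
    then show "(\<integral>\<^sup>+x. f (x, y) \<partial>(\<Pi>\<^sub>M i\<in>{..<n}. D)) \<le> ennreal (2 ^ card m)"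
      by (simp add: f_def inprod_def sqnorm_def)
  qed
  also have "\<dots> = ennreal (2 ^ card m)" using TW.emeasure_space_1 by simp
  finally show ?thesis .
qed

definition noise_size ::
    "nat \<Rightarrow> (nat \<Rightarrow> nat \<Rightarrow> real) \<Rightarrow> (nat \<Rightarrow> real) \<Rightarrow> (nat \<Rightarrow> real) \<Rightarrow> nat set \<Rightarrow> real" where
  "noise_size n Z mu e m = sqnorm n (proj n Z m e) +
     (inprod n e (proj_perp n Z m mu))\<^sup>2 / sqnorm n (proj_perp n Z m mu)"

text \<open>Models use columns below \<open>p\<close>, so index \<open>p\<close> is free to store
  \<open>mu\<close>; one Gram-Schmidt step then produces the quotient.\<close>

lemma noise_size_eq:
  assumes "finite m" "p \<notin> m"
  shows "noise_size n Z mu e m = sqnorm n (proj n (\<lambda>i j. if j = p then mu i else Z i j) (insert p m) e)"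
proof -
  let ?Z = "\<lambda>i j. if j = p then mu i else Z i j"
  have "proj n ?Z m y = proj n Z m y" for y
    using assms by (intro proj_cong) auto
  then show ?thesis
    by (simp add: sqnorm_proj_insert[OF assms(1)] noise_size_def proj_perp_def)
qed

text \<open>Chernoff's bound, phrased with the non-negative integral so that no integrability has to
  be established.\<close>

lemma (in prob_space) prob_gt_le_exp_moment:
  assumes f: "f \<in> borel_measurable M" and l: "l \<ge> 0"
    and C: "(\<integral>\<^sup>+\<omega>. exp (l * f \<omega>) \<partial>M) \<le> ennreal C" "C \<ge> 0"
  shows "prob {\<omega>\<in>space M. f \<omega> > t} \<le> exp (- (l * t)) * C"
proof -
  have [measurable]: "f \<in> borel_measurable M" by fact
  have "emeasure M {\<omega>\<in>space M. f \<omega> > t} \<le>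
      emeasure M {\<omega>\<in>space M. 1 \<le> ennreal (exp (- (l * t))) * ennreal (exp (l * f \<omega>))}"
  proof (rule emeasure_mono)
    show "{\<omega>\<in>space M. f \<omega> > t} \<subseteq> {\<omega>\<in>space M. 1 \<le> ennreal (exp (- (l * t))) * ennreal (exp (l * f \<omega>))}"
    proof safe
      fix \<omega> assume "f \<omega> > t"
      then have "1 \<le> exp (- (l * t)) * exp (l * f \<omega>)"
        using l by (simp add: exp_add[symmetric] mult_left_mono)
      then show "1 \<le> ennreal (exp (- (l * t))) * ennreal (exp (l * f \<omega>))"
        by (simp add: ennreal_mult'[symmetric])
    qed
  qed measurable
  also have "\<dots> \<le> ennreal (exp (- (l * t))) * (\<integral>\<^sup>+\<omega>. ennreal (exp (l * f \<omega>)) * indicator (space M) \<omega> \<partial>M)"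
    by (rule nn_integral_Markov_inequality) auto
  also have "\<dots> = ennreal (exp (- (l * t))) * (\<integral>\<^sup>+\<omega>. exp (l * f \<omega>) \<partial>M)"
    by (intro arg_cong2[where f="(*)"] refl nn_integral_cong) simp
  also have "\<dots> \<le> ennreal (exp (- (l * t))) * ennreal C"
    using C by (intro mult_left_mono) auto
  finally have "emeasure M {\<omega>\<in>space M. f \<omega> > t} \<le> ennreal (exp (- (l * t)) * C)"
    by (simp add: ennreal_mult')
  then show ?thesis
    using C(2) by (subst (asm) emeasure_eq_measure) (simp add: ennreal_le_iff)
qed

lemma (in prob_space) distr_PiM_iid:
  assumes "n > 0" and ind: "indep_vars (\<lambda>_. borel) (\<lambda>i \<omega>. X \<omega> i) {..<n}"
    and law: "\<And>i. i < n \<Longrightarrow> distr M borel (\<lambda>\<omega>. X \<omega> i) = D"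
  shows "distr M (\<Pi>\<^sub>M i\<in>{..<n}. borel) (\<lambda>\<omega>. \<lambda>i\<in>{..<n}. X \<omega> i) = (\<Pi>\<^sub>M i\<in>{..<n}. D)"
proof -
  have "distr M (\<Pi>\<^sub>M i\<in>{..<n}. borel) (\<lambda>\<omega>. \<lambda>i\<in>{..<n}. X \<omega> i) =
      (\<Pi>\<^sub>M i\<in>{..<n}. distr M borel (\<lambda>\<omega>. X \<omega> i))"
    using assms(1) ind
    by (subst indep_vars_iff_distr_eq_PiM'[symmetric]) (auto simp: indep_vars_def)
  also have "\<dots> = (\<Pi>\<^sub>M i\<in>{..<n}. D)" using law by (intro PiM_cong) auto
  finally show ?thesis .
qed

section \<open>Moments of signal and noise\<close>

lemma integrable_pair_mult:
  fixes f g :: "real \<Rightarrow> real"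
  assumes D1: "real_distribution D1" and D2: "real_distribution D2"
    and f: "integrable D1 f" and g: "integrable D2 g"
  shows "integrable (D1 \<Otimes>\<^sub>M D2) (\<lambda>z. f (fst z) * g (snd z))"
    and "(\<integral>z. f (fst z) * g (snd z) \<partial>(D1 \<Otimes>\<^sub>M D2)) = (\<integral>x. f x \<partial>D1) * (\<integral>y. g y \<partial>D2)"
proof -
  interpret D1: real_distribution D1 by fact
  interpret D2: real_distribution D2 by fact
  interpret Q: pair_prob_space D1 D2 by unfold_locales
  have [measurable]: "f \<in> borel_measurable borel" "g \<in> borel_measurable borel"
    using f g by (auto dest: borel_measurable_integrable)
  show int: "integrable (D1 \<Otimes>\<^sub>M D2) (\<lambda>z. f (fst z) * g (snd z))"
  proof (rule Q.Fubini_integrable)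
    show "(\<lambda>z. f (fst z) * g (snd z)) \<in> borel_measurable (D1 \<Otimes>\<^sub>M D2)" by measurable
    show "integrable D1 (\<lambda>x. LINT y|D2. norm (f (fst (x, y)) * g (snd (x, y))))"
      using f by (simp add: abs_mult)
  qed (use g in auto)
  show "(\<integral>z. f (fst z) * g (snd z) \<partial>(D1 \<Otimes>\<^sub>M D2)) = (\<integral>x. f x \<partial>D1) * (\<integral>y. g y \<partial>D2)"
    using Q.integral_fst'[OF int] by simp
qed

lemma (in real_distribution) integrable_power_le_4:
  assumes "integrable M (\<lambda>x. x ^ 4)" "k \<le> 4"
  shows "integrable M (\<lambda>x. x ^ k)"
proof (rule Bochner_Integration.integrable_bound)
  show "integrable M (\<lambda>x. 1 + x ^ 4)" using assms by simp
  have "\<bar>x\<bar> ^ k \<le> 1 + x ^ 4" for x :: real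
  proof (cases "\<bar>x\<bar> \<le> 1")
    case True
    then have "\<bar>x\<bar> ^ k \<le> 1" by (intro power_le_one) auto
    then show ?thesis by (simp add: add_increasing2)
  next
    case False
    then have "\<bar>x\<bar> ^ k \<le> \<bar>x\<bar> ^ 4" using assms by (intro power_increasing) auto
    then show ?thesis by (simp add: power_even_abs)
  qed
  then show "AE x in M. norm (x ^ k) \<le> norm (1 + x ^ 4)"
    by (auto simp: power_abs intro!: AE_I2 order_trans[OF _ abs_ge_self])
qed simp

text \<open>\<open>x\<^sup>2 / 2\<close> is at most \<open>exp \<bar>x\<bar>\<close>, and the
  exponential moments at 1 and -1 are finite.\<close>

lemma subgaussian_integrable_sq:
  assumes "real_distribution D" "subgaussian D K"
  shows "integrable D (\<lambda>x. x\<^sup>2)"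
proof (rule Bochner_Integration.integrable_bound)
  interpret real_distribution D by fact
  show "(\<lambda>x. x\<^sup>2) \<in> borel_measurable D" by simp
  show "integrable D (\<lambda>x. 2 * (exp (1 * x) + exp ((-1) * x)))"
    using assms(2) unfolding subgaussian_def by (intro integrable_mult_right Bochner_Integration.integrable_add) blast+
  have "x\<^sup>2 \<le> 2 * (exp x + exp (- x))" for x :: real
  proof (cases "0 \<le> x")
    case True
    then have "x\<^sup>2 / 2 \<le> exp x" using exp_lower_Taylor_quadratic[of x] by simp
    then show ?thesis using exp_ge_zero[of "- x"] by (simp del: exp_ge_zero)
  next
    case False
    then have "x\<^sup>2 / 2 \<le> exp (- x)" using exp_lower_Taylor_quadratic[of "- x"] by simp
    then show ?thesis using exp_ge_zero[of x] by (simp del: exp_ge_zero)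
  qed
  then show "AE x in D. norm (x\<^sup>2) \<le> norm (2 * (exp (1 * x) + exp ((-1) * x)))"
    by (auto intro!: AE_I2 order_trans[OF _ abs_ge_self])
qed

text \<open>
  Degenerate designs are covered: if \<open>p n \<le> 1\<close>, then \<open>ln (p n) = 0\<close> and \<open>x / 0 = 0\<close> force \<open>u n = 0\<close>.
\<close>

lemma sparsity_bounds:
  fixes u p :: "nat \<Rightarrow> nat"
  assumes u: "(\<lambda>n. real (u n)) \<in> o(\<lambda>n. sqrt (real n) / ln (real (p n)))" and c: "c > 0"
  shows "eventually (\<lambda>n. u n * ln (p n) \<le> c * sqrt n \<and> u n \<le> c * sqrt n) sequentially"
proof -
  \<comment> \<open>The factor \<open>ln 2\<close> prepares the second claim: dividing by
    \<open>ln (p n) \<ge> ln 2\<close> turns the bound on \<open>u n * ln (p n)\<close> into one on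
    \<open>u n\<close>.\<close>
  have "eventually (\<lambda>n. norm (real (u n)) \<le> (c * ln 2) * norm (sqrt (real n) / ln (real (p n)))) sequentially"
    using c by (intro landau_o.smallD[OF u]) simp
  then show ?thesis
  proof eventually_elim
    case (elim n)
    show ?case
    proof (cases "p n \<le> 1")
      case True
      then have "ln (real (p n)) = 0" by (cases "p n") auto
      then show ?thesis using elim c by simp
    next
      case False
      then have L: "ln 2 \<le> ln (real (p n))" by (subst ln_le_cancel_iff) auto
      have l2: "0 < ln (2::real)" by simp
      have "real (u n) \<le> c * ln 2 * sqrt n / ln (p n)"
        using elim L l2 by (simp add: abs_of_nonneg)
      then have 1: "u n * ln (p n) \<le> c * ln 2 * sqrt n"
        using L l2 by (simp add: pos_le_divide_eq)
      have "ln (2::real) \<le> 1" using ln_2_less_1 by simp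
      then have "c * sqrt n * ln 2 \<le> c * sqrt n * 1" using c by (intro mult_left_mono) auto
      then have 2: "c * ln 2 * sqrt n \<le> c * sqrt n" by (simp add: mult_ac)
      have "u n * ln 2 \<le> u n * ln (p n)" using L by (intro mult_left_mono) auto
      then have "u n * ln 2 \<le> c * sqrt n * ln 2" using 1 by (simp only: mult.assoc mult.commute[of "ln 2"])
      then have "u n \<le> c * sqrt n" using l2 by (rule mult_right_le_imp_le)
      then show ?thesis using 1 2 by linarith
    qed
  qed
qed

text \<open>A crude count suffices, because \<open>u * ln p\<close> is exactly the quantity that
  (C3) makes o(sqrt n).\<close>

lemma card_subsets_card_le_exp:
  assumes "u \<le> p"
  shows "real (card (subsets_card p u)) \<le> exp (u * ln p)"
proof (cases "p = 0")
  case False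
  have "real (p choose u) \<le> real (p ^ u)"
    using binomial_le_pow[OF assms] by (simp only: of_nat_le_iff)
  also have "\<dots> = exp (u * ln p)" using False by (simp add: exp_of_nat_mult)
  finally show ?thesis by (simp add: card_subsets_card)
qed (use assms in \<open>simp add: card_subsets_card\<close>)

lemma measurable_sigma_generator:
  assumes "G \<subseteq> Pow \<Omega>" "f \<in> \<Omega> \<rightarrow> space N" "\<And>A. A \<in> sets N \<Longrightarrow> f -` A \<inter> \<Omega> \<in> G"
  shows "f \<in> measurable (sigma \<Omega> G) N"
  using assms by (intro measurableI) (auto simp: space_measure_of sets_measure_of)

text \<open>Union bound over the models, with Chernoff's bound for each. The power
  \<open>Suc u\<close> counts the \<open>u\<close> columns and the adjoined signal.\<close>

lemma (in prob_space) noise_size_tail: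
  fixes e mu :: "'a \<Rightarrow> nat \<Rightarrow> real" and Z :: "'a \<Rightarrow> nat \<Rightarrow> nat \<Rightarrow> real" and n p :: nat
  defines "GE \<equiv> (\<Union>i<n. {(\<lambda>\<omega>. e \<omega> i) -` A \<inter> space M | A. A \<in> sets borel})"
    and "GM \<equiv> (\<Union>i<n. {(\<lambda>\<omega>. mu \<omega> i) -` A \<inter> space M | A. A \<in> sets borel}) \<union>
      (\<Union>i<n. \<Union>j<p. {(\<lambda>\<omega>. Z \<omega> i j) -` A \<inter> space M | A. A \<in> sets borel})"
  assumes "n > 0"
    and rv: "\<And>i. random_variable borel (\<lambda>\<omega>. e \<omega> i)" "\<And>i. random_variable borel (\<lambda>\<omega>. mu \<omega> i)"
      "\<And>i j. random_variable borel (\<lambda>\<omega>. Z \<omega> i j)"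
    and e_ind: "indep_vars (\<lambda>_. borel) (\<lambda>i \<omega>. e \<omega> i) {..<n}"
    and e_law: "\<And>i. i < n \<Longrightarrow> distr M borel (\<lambda>\<omega>. e \<omega> i) = D"
    and ind: "indep_set (sigma_sets (space M) GE) (sigma_sets (space M) GM)"
    and D: "subgaussian D K" and \<alpha>: "\<alpha> > 4 * K\<^sup>2"
  shows "prob {\<omega>\<in>space M. \<exists>m\<in>subsets_card p u. noise_size n (Z \<omega>) (mu \<omega>) (e \<omega>) m > t}
    \<le> card (subsets_card p u) * (exp (- (3 / (2 * \<alpha>) * t)) * 2 ^ Suc u)"
proof -
  let ?S = "\<Pi>\<^sub>M i\<in>{..<n}. borel :: real measure"
  let ?TZ = "\<Pi>\<^sub>M ij\<in>{..<n}\<times>{..<p}. borel :: real measure"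
  let ?T = "?S \<Otimes>\<^sub>M ?TZ"
  let ?X = "\<lambda>\<omega>. \<lambda>i\<in>{..<n}. e \<omega> i"
  define W where "W \<omega> = (\<lambda>i\<in>{..<n}. mu \<omega> i, \<lambda>ij\<in>{..<n}\<times>{..<p}. Z \<omega> (fst ij) (snd ij))" for \<omega>
  have GE: "GE \<subseteq> Pow (space M)" and GM: "GM \<subseteq> Pow (space M)" by (auto simp: GE_def GM_def)
  have X: "?X \<in> measurable (sigma (space M) GE) ?S"
    using GE by (intro measurable_restrict measurable_sigma_generator) (auto simp: GE_def)
  have W: "W \<in> measurable (sigma (space M) GM) ?T"
    unfolding W_def using GM
    by (intro measurable_Pair measurable_restrict measurable_sigma_generator) (auto simp: GM_def)
  note law = indep_set_imp_joint_law[OF ind GE GM X W]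
  have D': "real_distribution D"
    using e_law[of 0] \<open>n > 0\<close> rv(1)[of 0] by (metis real_distribution_distr)
  have joint: "distr M (?S \<Otimes>\<^sub>M ?T) (\<lambda>\<omega>. (?X \<omega>, W \<omega>)) = (\<Pi>\<^sub>M i\<in>{..<n}. D) \<Otimes>\<^sub>M distr M ?T W"
    using law(3) distr_PiM_iid[OF \<open>n > 0\<close> e_ind e_law] by simp
  have \<alpha>0: "\<alpha> > 0" using \<alpha> zero_le_power2[of K] by linarith
  \<comment> \<open>Unpacks a value of \<open>W\<close> into the extended matrix, with the signal in
    column \<open>p\<close>.\<close>
  define Zf where "Zf y i j = (if j = p then fst y i else snd y (i, j))" for y :: "(nat \<Rightarrow> real) \<times> (nat \<times> nat \<Rightarrow> real)" and i j
  let ?N = "\<lambda>m \<omega>. noise_size n (Z \<omega>) (mu \<omega>) (e \<omega>) m"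
  have single: "prob {\<omega>\<in>space M. ?N m \<omega> > t} \<le> exp (- (3 / (2 * \<alpha>) * t)) * 2 ^ Suc u"
    and meas: "?N m \<in> borel_measurable M" if m: "m \<in> subsets_card p u" for m
  proof -
    have fin: "finite m" and lt: "\<And>j. j \<in> m \<Longrightarrow> j < p" and card: "card m = u"
      using m finite_of_subsets_card[OF m] by (auto simp: subsets_card_def)
    then have pm: "p \<notin> m" by auto
    have eq: "?N m \<omega> = sqnorm n (proj n (Zf (W \<omega>)) (insert p m) (e \<omega>))" for \<omega>
    proof -
      have "proj n (\<lambda>i j. if j = p then mu \<omega> i else Z \<omega> i j) (insert p m) (e \<omega>) =
          proj n (Zf (W \<omega>)) (insert p m) (e \<omega>)"
        using lt by (intro proj_cong) (auto simp: Zf_def W_def)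
      then show ?thesis by (simp add: noise_size_eq[OF fin pm])
    qed
    have Zf: "(\<lambda>y. Zf y i j) \<in> borel_measurable ?T" if "i < n" "j \<in> insert p m" for i j
    proof (cases "j = p")
      case True
      then show ?thesis unfolding Zf_def using that
        by (simp add: measurable_compose[OF measurable_fst measurable_component_singleton])
    next
      case False
      then have "(i, j) \<in> {..<n} \<times> {..<p}" using that lt by auto
      from measurable_compose[OF measurable_snd measurable_component_singleton[OF this]]
      show ?thesis unfolding Zf_def using False by simp
    qed
    have "(\<lambda>\<omega>. Zf (W \<omega>) i j) \<in> borel_measurable M" if "i < n" "j \<in> insert p m" for i j
      using law(2) Zf[OF that] by (rule measurable_compose)
    then show meas: "?N m \<in> borel_measurable M"
      unfolding eq using fin rv(1) by (intro measurable_sqnorm measurable_proj) auto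
    \<comment> \<open>Here the tuning constant meets the noise: \<open>\<alpha> / 4\<close>
      dominates \<open>K\<^sup>2\<close>, and its product with \<open>3 / (2 * \<alpha>)\<close> is
      \<open>3 / 8\<close>.\<close>
    have "(\<integral>\<^sup>+\<omega>. exp (3 / (2 * \<alpha>) * ?N m \<omega>) \<partial>M) \<le> ennreal (2 ^ card (insert p m))"
      unfolding eq
      by (rule exp_moment_random_design[OF rv(1) law(2) joint D' D, where k="\<alpha> / 4"])
        (use \<alpha> \<alpha>0 fin Zf in auto)
    then show "prob {\<omega>\<in>space M. ?N m \<omega> > t} \<le> exp (- (3 / (2 * \<alpha>) * t)) * 2 ^ Suc u"
      using meas \<alpha>0 fin pm card by (intro prob_gt_le_exp_moment) auto
  qed
  have "{\<omega>\<in>space M. \<exists>m\<in>subsets_card p u. ?N m \<omega> > t} = (\<Union>m\<in>subsets_card p u. {\<omega>\<in>space M. ?N m \<omega> > t})"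
    by auto
  also have "prob \<dots> \<le> (\<Sum>m\<in>subsets_card p u. prob {\<omega>\<in>space M. ?N m \<omega> > t})"
    using meas by (intro finite_measure_subadditive_finite) auto
  also have "\<dots> \<le> (\<Sum>m\<in>subsets_card p u. exp (- (3 / (2 * \<alpha>) * t)) * 2 ^ Suc u)"
    by (intro sum_mono single)
  finally show ?thesis by simp
qed

text \<open>Under the joint law the pairs of noise and signal entries are i.i.d., and the
  exponential of a sum is a product over the entries.\<close>

lemma (in prob_space) char_row_sum:
  fixes e mu :: "'a \<Rightarrow> nat \<Rightarrow> real" and h :: "real \<Rightarrow> real \<Rightarrow> real"
  assumes D: "real_distribution D1" "real_distribution D2"
    and rv: "\<And>i. random_variable borel (\<lambda>\<omega>. e \<omega> i)" "\<And>i. random_variable borel (\<lambda>\<omega>. mu \<omega> i)"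
    and joint: "distr M ((\<Pi>\<^sub>M i\<in>{..<n}. borel) \<Otimes>\<^sub>M (\<Pi>\<^sub>M i\<in>{..<n}. borel))
        (\<lambda>\<omega>. (\<lambda>i\<in>{..<n}. e \<omega> i, \<lambda>i\<in>{..<n}. mu \<omega> i)) = (\<Pi>\<^sub>M i\<in>{..<n}. D1) \<Otimes>\<^sub>M (\<Pi>\<^sub>M i\<in>{..<n}. D2)"
    and h: "(\<lambda>z. h (fst z) (snd z)) \<in> borel_measurable (borel \<Otimes>\<^sub>M borel)"
  shows "char (distr M borel (\<lambda>\<omega>. (\<Sum>i<n. h (e \<omega> i) (mu \<omega> i)) / sqrt n)) t =
    char (distr (D1 \<Otimes>\<^sub>M D2) borel (\<lambda>z. h (fst z) (snd z))) (t / sqrt n) ^ n"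
proof -
  interpret D1: real_distribution D1 by fact
  interpret D2: real_distribution D2 by fact
  let ?S = "\<Pi>\<^sub>M i\<in>{..<n}. borel :: real measure"
  let ?V = "\<lambda>\<omega>. (\<lambda>i\<in>{..<n}. e \<omega> i, \<lambda>i\<in>{..<n}. mu \<omega> i)"
  note [measurable] = h
  define f where "f x y = iexp (t / sqrt n * h x y)" for x y
  have f: "(\<lambda>z. f (fst z) (snd z)) \<in> borel_measurable (borel \<Otimes>\<^sub>M borel)"
    unfolding f_def by measurable
  have hm: "(\<lambda>\<omega>. h (e \<omega> i) (mu \<omega> i)) \<in> borel_measurable M" for i
    using measurable_compose[OF measurable_Pair[OF rv(1)[of i] rv(2)[of i]] h] by simp
  have V: "?V \<in> measurable M (?S \<Otimes>\<^sub>M ?S)"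
    using rv by (intro measurable_Pair measurable_restrict)
  have prodm: "(\<lambda>z. \<Prod>i<n. f (fst z i) (snd z i)) \<in> borel_measurable (?S \<Otimes>\<^sub>M ?S)"
  proof (rule borel_measurable_prod)
    fix i assume i: "i \<in> {..<n}"
    have "(\<lambda>z. (fst z i, snd z i)) \<in> measurable (?S \<Otimes>\<^sub>M ?S) (borel \<Otimes>\<^sub>M borel)"
      by (intro measurable_Pair measurable_compose[OF measurable_fst measurable_component_singleton[OF i]]
          measurable_compose[OF measurable_snd measurable_component_singleton[OF i]])
    from measurable_compose[OF this f]
    show "(\<lambda>z. f (fst z i) (snd z i)) \<in> borel_measurable (?S \<Otimes>\<^sub>M ?S)" by simp
  qed
  have "char (distr M borel (\<lambda>\<omega>. (\<Sum>i<n. h (e \<omega> i) (mu \<omega> i)) / sqrt n)) t =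
      (\<integral>\<omega>. iexp (t * ((\<Sum>i<n. h (e \<omega> i) (mu \<omega> i)) / sqrt n)) \<partial>M)"
    unfolding char_def using hm by (subst integral_distr) auto
  also have "\<dots> = (\<integral>\<omega>. (\<Prod>i<n. f (fst (?V \<omega>) i) (snd (?V \<omega>) i)) \<partial>M)"
  proof (rule Bochner_Integration.integral_cong[OF refl])
    fix \<omega>
    have "t * ((\<Sum>i<n. h (e \<omega> i) (mu \<omega> i)) / sqrt n) = (\<Sum>i<n. t / sqrt n * h (e \<omega> i) (mu \<omega> i))"
      by (simp add: sum_distrib_left sum_divide_distrib)
    then have "iexp (t * ((\<Sum>i<n. h (e \<omega> i) (mu \<omega> i)) / sqrt n)) = (\<Prod>i<n. f (e \<omega> i) (mu \<omega> i))"
      unfolding f_def by (simp only: of_real_sum sum_distrib_left exp_sum finite_lessThan)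
    then show "iexp (t * ((\<Sum>i<n. h (e \<omega> i) (mu \<omega> i)) / sqrt n)) =
        (\<Prod>i<n. f (fst (?V \<omega>) i) (snd (?V \<omega>) i))" by simp
  qed
  also have "\<dots> = (\<integral>z. (\<Prod>i<n. f (fst z i) (snd z i)) \<partial>distr M (?S \<Otimes>\<^sub>M ?S) ?V)"
    using V prodm by (rule integral_distr[symmetric])
  also have "\<dots> = (\<integral>z. f (fst z) (snd z) \<partial>(D1 \<Otimes>\<^sub>M D2)) ^ n"
    unfolding joint by (intro integral_prod_pair_PiM D f) (simp add: f_def del: of_real_mult)
  also have "(\<integral>z. f (fst z) (snd z) \<partial>(D1 \<Otimes>\<^sub>M D2)) =
      char (distr (D1 \<Otimes>\<^sub>M D2) borel (\<lambda>z. h (fst z) (snd z))) (t / sqrt n)"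
    unfolding char_def f_def by (subst integral_distr) auto
  finally show ?thesis .
qed

text \<open>Expand and integrate term by term: terms of degree one in the noise vanish with its
  mean, and the centring by \<open>s\<close> turns the fourth moment into the variance of the
  squared signal.\<close>

lemma signal_moments:
  fixes Dmu Deps :: "real measure"
  assumes Dmu: "real_distribution Dmu" and Deps: "real_distribution Deps"
    and mu4: "integrable Dmu (\<lambda>x. x ^ 4)" and mu1: "(\<integral>x. x \<partial>Dmu) = 0"
    and eps: "subgaussian Deps K"
  defines "s \<equiv> (\<integral>x. x\<^sup>2 \<partial>Dmu)"
    and "H \<equiv> (\<lambda>z. (snd z)\<^sup>2 + 2 * snd z * fst z - (\<integral>x. x\<^sup>2 \<partial>Dmu))"
  shows "integrable (Deps \<Otimes>\<^sub>M Dmu) H" "(\<integral>z. H z \<partial>(Deps \<Otimes>\<^sub>M Dmu)) = 0"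
    "integrable (Deps \<Otimes>\<^sub>M Dmu) (\<lambda>z. (H z)\<^sup>2)"
    "(\<integral>z. (H z)\<^sup>2 \<partial>(Deps \<Otimes>\<^sub>M Dmu)) = ((\<integral>x. x ^ 4 \<partial>Dmu) - s\<^sup>2) + 4 * (\<integral>x. x\<^sup>2 \<partial>Deps) * s"
proof -
  interpret M: real_distribution Dmu by fact
  interpret E: real_distribution Deps by fact
  have y: "integrable Dmu (\<lambda>x. x ^ k)" if "k \<le> 4" for k
    using M.integrable_power_le_4[OF mu4 that] .
  have x: "integrable Deps (\<lambda>x. x)" "integrable Deps (\<lambda>x. x\<^sup>2)" "(\<integral>x. x \<partial>Deps) = 0"
    using eps subgaussian_integrable_sq[OF Deps eps] by (auto simp: subgaussian_def)
  have one: "integrable Deps (\<lambda>_. 1::real)" "(\<integral>x. 1 \<partial>Deps) = (1::real)"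
    using E.prob_space by auto
  note m = integrable_pair_mult[OF Deps Dmu]
  have hb: "has_bochner_integral (Deps \<Otimes>\<^sub>M Dmu) (\<lambda>z. 1 * (snd z) ^ k) (\<integral>y. y ^ k \<partial>Dmu)"
    "has_bochner_integral (Deps \<Otimes>\<^sub>M Dmu) (\<lambda>z. fst z * (snd z) ^ k) 0"
    "has_bochner_integral (Deps \<Otimes>\<^sub>M Dmu) (\<lambda>z. (fst z)\<^sup>2 * (snd z) ^ k)
      ((\<integral>x. x\<^sup>2 \<partial>Deps) * (\<integral>y. y ^ k \<partial>Dmu))" if "k \<le> 4" for k
    unfolding has_bochner_integral_iff
    using m[OF one(1) y[OF that]] m[OF x(1) y[OF that]] m[OF x(2) y[OF that]] one x(3) by auto
  have y0: "(\<integral>y. y ^ 0 \<partial>Dmu) = 1" using M.prob_space by simp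
  \<comment> \<open>The factors \<open>1\<close> and the powers \<open>0\<close> and
    \<open>1\<close> are kept so that every summand has one of the three shapes in
    \<open>hb\<close>.\<close>
  have H: "H = (\<lambda>z. 1 * (snd z) ^ 2 + 2 * (fst z * (snd z) ^ 1) - s * (1 * (snd z) ^ 0))"
    by (simp add: H_def s_def fun_eq_iff)
  have H2: "(\<lambda>z. (H z)\<^sup>2) = (\<lambda>z. 1 * (snd z) ^ 4 + 4 * ((fst z)\<^sup>2 * (snd z) ^ 2) + s\<^sup>2 * (1 * (snd z) ^ 0)
      + 4 * (fst z * (snd z) ^ 3) - (2 * s) * (1 * (snd z) ^ 2) - (4 * s) * (fst z * (snd z) ^ 1))"
    by (simp add: H fun_eq_iff power2_eq_square power3_eq_cube power4_eq_xxxx algebra_simps)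
  have "has_bochner_integral (Deps \<Otimes>\<^sub>M Dmu) H
      ((\<integral>y. y ^ 2 \<partial>Dmu) + 2 * 0 - s * (\<integral>y. y ^ 0 \<partial>Dmu))"
    unfolding H
    by (intro has_bochner_integral_add has_bochner_integral_diff has_bochner_integral_mult_right hb) auto
  then show "integrable (Deps \<Otimes>\<^sub>M Dmu) H" "(\<integral>z. H z \<partial>(Deps \<Otimes>\<^sub>M Dmu)) = 0"
    using y0 by (auto simp: has_bochner_integral_iff s_def)
  have "has_bochner_integral (Deps \<Otimes>\<^sub>M Dmu) (\<lambda>z. (H z)\<^sup>2)
      ((\<integral>y. y ^ 4 \<partial>Dmu) + 4 * ((\<integral>x. x\<^sup>2 \<partial>Deps) * (\<integral>y. y ^ 2 \<partial>Dmu)) + s\<^sup>2 * (\<integral>y. y ^ 0 \<partial>Dmu)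
        + 4 * 0 - (2 * s) * (\<integral>y. y ^ 2 \<partial>Dmu) - (4 * s) * 0)"
    unfolding H2
    by (intro has_bochner_integral_add has_bochner_integral_diff has_bochner_integral_mult_right hb) auto
  then show "integrable (Deps \<Otimes>\<^sub>M Dmu) (\<lambda>z. (H z)\<^sup>2)"
    "(\<integral>z. (H z)\<^sup>2 \<partial>(Deps \<Otimes>\<^sub>M Dmu)) = ((\<integral>x. x ^ 4 \<partial>Dmu) - s\<^sup>2) + 4 * (\<integral>x. x\<^sup>2 \<partial>Deps) * s"
    using y0 by (auto simp: has_bochner_integral_iff s_def power2_eq_square)
qed

section \<open>Asymptotic normality\<close>

theorem mainTheorem14:
  fixes M :: "'a measure"
    and p u s :: "nat \<Rightarrow> nat"
    and Z :: "nat \<Rightarrow> 'a \<Rightarrow> nat \<Rightarrow> nat \<Rightarrow> real"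
    and mu eps :: "nat \<Rightarrow> 'a \<Rightarrow> nat \<Rightarrow> real"
    and Dmu Deps :: "real measure"
    and K \<alpha> :: real
    and S :: "nat \<Rightarrow> nat set"
  defines "Y \<equiv> (\<lambda>n \<omega> i. mu n \<omega> i + eps n \<omega> i)"
    and "\<sigma>\<mu>2 \<equiv> (\<integral>x. x\<^sup>2 \<partial>Dmu)"
    and "\<kappa>\<mu> \<equiv> (\<integral>x. x ^ 4 \<partial>Dmu) - (\<integral>x. x\<^sup>2 \<partial>Dmu)\<^sup>2"
    and "\<sigma>\<epsilon>2 \<equiv> (\<integral>x. x\<^sup>2 \<partial>Deps)"
  assumes M: "prob_space M"
    (* measurability *)
    and Z_rv: "\<And>n i j. (\<lambda>\<omega>. Z n \<omega> i j) \<in> borel_measurable M"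
    and mu_rv: "\<And>n i. (\<lambda>\<omega>. mu n \<omega> i) \<in> borel_measurable M"
    and eps_rv: "\<And>n i. (\<lambda>\<omega>. eps n \<omega> i) \<in> borel_measurable M"
    (* (C1) *)
    and mu_law: "\<And>n i. i < n \<Longrightarrow> distr M borel (\<lambda>\<omega>. mu n \<omega> i) = Dmu"
    and mu_indep: "\<And>n. prob_space.indep_vars M (\<lambda>_. borel) (\<lambda>i \<omega>. mu n \<omega> i) {..<n}"
    and mu_mean: "(\<integral>x. x \<partial>Dmu) = 0"
    and mu_4th: "integrable Dmu (\<lambda>x. x ^ 4)"
    (* (C2) *)
    and eps_law: "\<And>n i. i < n \<Longrightarrow> distr M borel (\<lambda>\<omega>. eps n \<omega> i) = Deps"
    and eps_indep: "\<And>n. prob_space.indep_vars M (\<lambda>_. borel) (\<lambda>i \<omega>. eps n \<omega> i) {..<n}"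
    and eps_subg: "subgaussian Deps K"
    and eps_indep_Zmu: "\<And>n. prob_space.indep_set M
          (sigma_sets (space M) (\<Union>i<n. {(\<lambda>\<omega>. eps n \<omega> i) -` A \<inter> space M | A. A \<in> sets borel}))
          (sigma_sets (space M)
             ((\<Union>i<n. {(\<lambda>\<omega>. mu n \<omega> i) -` A \<inter> space M | A. A \<in> sets borel}) \<union>
              (\<Union>i<n. \<Union>j<p n. {(\<lambda>\<omega>. Z n \<omega> i j) -` A \<inter> space M | A. A \<in> sets borel})))"
    (* (C3) *)
    and S_card: "\<And>n. S n \<in> subsets_card (p n) (s n)"
    and sparse: "tendsto_prob_zero M (\<lambda>n \<omega>. sqnorm n (proj_perp n (Z n \<omega>) (S n) (mu n \<omega>)) / sqrt (real n))"
    and u_ge_s: "eventually (\<lambda>n. s n \<le> u n) sequentially"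
    and u_small: "(\<lambda>n. real (u n)) \<in> o(\<lambda>n. sqrt (real n) / ln (real (p n)))"
    and u_le_p: "\<And>n. u n \<le> p n"
    (* tuning constant and variance *)
    and alpha: "\<alpha> > 4 * K\<^sup>2"
    and var_pos: "\<sigma>\<mu>2 > 0"
  shows "\<forall>est \<in> {sigma_hat_I, sigma_hat_II, sigma_hat_III}.
           weak_conv_m
             (\<lambda>n. distr M borel (\<lambda>\<omega>. sqrt (real n) * (est \<alpha> n (p n) (u n) (Z n \<omega>) (Y n \<omega>) - \<sigma>\<mu>2)))
             (normal_measure (\<kappa>\<mu> + 4 * \<sigma>\<epsilon>2 * \<sigma>\<mu>2))"
proof
  fix est assume est: "est \<in> {sigma_hat_I, sigma_hat_II, sigma_hat_III}"
  interpret prob_space M by fact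
  note [measurable] = Z_rv mu_rv eps_rv
  have Dmu: "real_distribution Dmu"
    using mu_law[of 0 1] real_distribution_distr[OF mu_rv[of 1 0]] by simp
  have Deps: "real_distribution Deps"
    using eps_law[of 0 1] real_distribution_distr[OF eps_rv[of 1 0]] by simp
  interpret Dmu: real_distribution Dmu by fact
  interpret Deps: real_distribution Deps by fact
  interpret Q: pair_prob_space Deps Dmu by unfold_locales
  have \<alpha>0: "\<alpha> > 0" using alpha zero_le_power2[of K] by linarith
  define v where "v = \<kappa>\<mu> + 4 * \<sigma>\<epsilon>2 * \<sigma>\<mu>2"
  \<comment> \<open>One centred summand of the limiting row sum. The noise is the first argument,
    matching the order in the joint law.\<close>
  define h where "h x y = y\<^sup>2 + 2 * y * x - \<sigma>\<mu>2" for x y :: real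
  define H where "H = (\<lambda>z. h (fst z) (snd z))"
  have Hm [measurable]: "H \<in> borel_measurable (borel \<Otimes>\<^sub>M borel)" unfolding H_def h_def by measurable
  have mom: "integrable (Deps \<Otimes>\<^sub>M Dmu) H" "(\<integral>z. H z \<partial>(Deps \<Otimes>\<^sub>M Dmu)) = 0"
    "integrable (Deps \<Otimes>\<^sub>M Dmu) (\<lambda>z. (H z)\<^sup>2)" "(\<integral>z. (H z)\<^sup>2 \<partial>(Deps \<Otimes>\<^sub>M Dmu)) = v"
    using signal_moments[OF Dmu Deps mu_4th mu_mean eps_subg]
    unfolding H_def h_def v_def \<sigma>\<mu>2_def \<kappa>\<mu>_def \<sigma>\<epsilon>2_def by simp_all
  have v0: "v \<ge> 0" unfolding mom(4)[symmetric] by simp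
  define DH where "DH = distr (Deps \<Otimes>\<^sub>M Dmu) borel H"
  have HQ [measurable]: "H \<in> borel_measurable (Deps \<Otimes>\<^sub>M Dmu)" using mom(1) by simp
  interpret DH: real_distribution DH unfolding DH_def by (rule Q.real_distribution_distr) simp
  have DH: "integrable DH (\<lambda>x. x)" "DH.expectation (\<lambda>x. x) = 0"
    "integrable DH (\<lambda>x. x\<^sup>2)" "DH.expectation (\<lambda>x. x\<^sup>2) = v"
    using mom by (simp_all add: DH_def integrable_distr_eq integral_distr)
  define X where "X n \<omega> = (\<Sum>i<n. h (eps n \<omega> i) (mu n \<omega> i)) / sqrt n" for n \<omega>
  define R where "R n \<omega> = sqrt n * (est \<alpha> n (p n) (u n) (Z n \<omega>) (Y n \<omega>) - \<sigma>\<mu>2)" for n \<omega>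
  have Xm [measurable]: "X n \<in> borel_measurable M" for n
    unfolding X_def h_def by measurable
  have Rm [measurable]: "R n \<in> borel_measurable M" for n
  proof -
    have "(\<lambda>\<omega>. est \<alpha> n (p n) (u n) (Z n \<omega>) (Y n \<omega>)) \<in> borel_measurable M"
      by (rule measurable_sigma_hat[where Z="Z n" and Y="Y n" and est=est, OF Z_rv _ est])
        (simp add: Y_def)
    then show ?thesis unfolding R_def by measurable
  qed
  have X_char: "(\<lambda>n. char (distr M borel (X n)) t) \<longlonglongrightarrow> char (normal_measure v) t" for t
  proof -
    have "char (distr M borel (X n)) t = char DH (t / sqrt n) ^ n" if "n > 0" for n
    proof -
      let ?GE = "\<Union>i<n. {(\<lambda>\<omega>. eps n \<omega> i) -` A \<inter> space M | A. A \<in> sets borel}"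
      let ?GM = "(\<Union>i<n. {(\<lambda>\<omega>. mu n \<omega> i) -` A \<inter> space M | A. A \<in> sets borel}) \<union>
        (\<Union>i<n. \<Union>j<p n. {(\<lambda>\<omega>. Z n \<omega> i j) -` A \<inter> space M | A. A \<in> sets borel})"
      have GE: "?GE \<subseteq> Pow (space M)" and GM: "?GM \<subseteq> Pow (space M)" by auto
      have E: "(\<lambda>\<omega>. \<lambda>i\<in>{..<n}. eps n \<omega> i) \<in> measurable (sigma (space M) ?GE) (\<Pi>\<^sub>M i\<in>{..<n}. borel)"
        using GE by (intro measurable_restrict measurable_sigma_generator) auto
      \<comment> \<open>The generator also contains events of the design; the signal alone is
        measurable for it too, which is all that the limit law needs.\<close>
      have U: "(\<lambda>\<omega>. \<lambda>i\<in>{..<n}. mu n \<omega> i) \<in> measurable (sigma (space M) ?GM) (\<Pi>\<^sub>M i\<in>{..<n}. borel)"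
        using GM by (intro measurable_restrict measurable_sigma_generator) auto
      have joint: "distr M ((\<Pi>\<^sub>M i\<in>{..<n}. borel) \<Otimes>\<^sub>M (\<Pi>\<^sub>M i\<in>{..<n}. borel))
          (\<lambda>\<omega>. (\<lambda>i\<in>{..<n}. eps n \<omega> i, \<lambda>i\<in>{..<n}. mu n \<omega> i)) =
          (\<Pi>\<^sub>M i\<in>{..<n}. Deps) \<Otimes>\<^sub>M (\<Pi>\<^sub>M i\<in>{..<n}. Dmu)"
        using indep_set_imp_joint_law(3)[OF eps_indep_Zmu GE GM E U]
          distr_PiM_iid[OF that eps_indep eps_law] distr_PiM_iid[OF that mu_indep mu_law] by simp
      show ?thesis
        unfolding X_def[abs_def] DH_def H_def
        using Hm by (intro char_row_sum Deps Dmu eps_rv mu_rv joint) (simp add: H_def)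
    qed
    then have ev: "eventually (\<lambda>n. char DH (t / sqrt n) ^ n = char (distr M borel (X n)) t) sequentially"
      by (intro eventually_sequentiallyI[of 1]) simp
    have "(\<lambda>n. char DH (t / sqrt n) ^ n) \<longlonglongrightarrow> complex_of_real (exp (- (v * t\<^sup>2) / 2))"
      by (rule DH.char_power_tendsto[OF DH])
    then show ?thesis using Lim_transform_eventually[OF _ ev] by (simp add: char_normal_measure[OF v0])
  qed
  have "tendsto_prob_zero M (\<lambda>n \<omega>. R n \<omega> - X n \<omega>)"
    unfolding tendsto_prob_zero_def
  proof (intro allI impI)
    fix d :: real assume d: "d > 0"
    \<comment> \<open>Here 22 = 14 + 5 + 3, the coefficients of the deterministic bound, whose three
      quantities will each be at most \<open>\<tau> * sqrt n\<close>.\<close>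
    define \<tau> where "\<tau> = d / 22"
    have \<tau>: "\<tau> > 0" using d by (simp add: \<tau>_def)
    let ?Q = "\<lambda>n \<omega>. sqnorm n (proj_perp n (Z n \<omega>) (S n) (mu n \<omega>)) / sqrt n"
    let ?I = "\<lambda>n. subsets_card (p n) (u n)"
    let ?bad = "\<lambda>n. {\<omega>\<in>space M. \<exists>m\<in>?I n. noise_size n (Z n \<omega>) (mu n \<omega>) (eps n \<omega>) m > \<tau> * sqrt n}"
    let ?far = "\<lambda>n. {\<omega>\<in>space M. \<bar>?Q n \<omega>\<bar> > \<tau>}"
    define l where "l = 3 / (2 * \<alpha>)"
    have l: "l > 0" using \<alpha>0 by (simp add: l_def)
    \<comment> \<open>The first entry keeps the Gibbs penalty below \<open>\<tau> * sqrt n\<close>.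
      The second gives the tail a decay rate of at least \<open>4 * c\<close>, of which the number
      of models and the factor \<open>2 ^ u\<close> use \<open>c\<close> each, so
      \<open>2 * c\<close> remains.\<close>
    define c where "c = min (\<tau> / \<alpha>) (l * \<tau> / 4)"
    have c: "c > 0" "\<alpha> * c \<le> \<tau>" "4 * c \<le> l * \<tau>"
      using \<tau> \<alpha>0 l by (auto simp: c_def min_def field_simps)
    have bad_le: "prob (?bad n) \<le> 2 * exp (- (2 * c * sqrt n))"
      if "n > 0" "u n * ln (p n) \<le> c * sqrt n \<and> u n \<le> c * sqrt n" for n
    proof -
      have "prob (?bad n) \<le> card (?I n) * (exp (- (l * (\<tau> * sqrt n))) * 2 ^ Suc (u n))"
        unfolding l_def
        by (rule noise_size_tail[OF that(1) eps_rv mu_rv Z_rv eps_indep eps_law eps_indep_Zmu eps_subg alpha])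
      also have "\<dots> \<le> exp (c * sqrt n) * (exp (- (4 * c * sqrt n)) * (2 * exp (c * sqrt n)))"
      proof (intro mult_mono)
        show "real (card (?I n)) \<le> exp (c * sqrt n)"
          using card_subsets_card_le_exp[OF u_le_p[of n]] that(2) by (meson exp_le_cancel_iff order_trans)
        show "exp (- (l * (\<tau> * sqrt n))) \<le> exp (- (4 * c * sqrt n))"
          using mult_right_mono[OF c(3), of "sqrt n"] by (simp add: mult.assoc)
        have "(2::real) ^ u n \<le> exp 1 ^ u n"
          using exp_ge_add_one_self[of 1] by (intro power_mono) auto
        also have "\<dots> = exp (u n)" by (simp add: exp_of_nat_mult[symmetric])
        also have "\<dots> \<le> exp (c * sqrt n)" using that(2) by simp
        finally show "(2::real) ^ Suc (u n) \<le> 2 * exp (c * sqrt n)" by simp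
      qed auto
      also have "\<dots> = 2 * exp (- (2 * c * sqrt n))"
        by (simp add: exp_add[symmetric] mult_ac)
      finally show ?thesis .
    qed
    have incl: "{\<omega>\<in>space M. \<bar>R n \<omega> - X n \<omega>\<bar> > d} \<subseteq> ?bad n \<union> ?far n"
      if n: "n > 0" and su: "s n \<le> u n" and uc: "u n * ln (p n) \<le> c * sqrt n" for n
    proof (rule subsetI, rule ccontr)
      fix \<omega> assume \<omega>: "\<omega> \<in> {\<omega>\<in>space M. \<bar>R n \<omega> - X n \<omega>\<bar> > d}" and nb: "\<omega> \<notin> ?bad n \<union> ?far n"
      have sq: "sqrt n > 0" using n by simp
      \<comment> \<open>The sparse set may have fewer than \<open>u n\<close> columns; any extension
        to a model has no larger bias and serves as comparison model.\<close>
      obtain k where k: "S n \<subseteq> k" "k \<in> ?I n"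
        using subsets_card_extend[OF S_card[of n] su u_le_p[of n]] by blast
      have "?Q n \<omega> \<le> \<tau>" using nb \<omega> by auto
      then have "sqnorm n (proj_perp n (Z n \<omega>) (S n) (mu n \<omega>)) \<le> \<tau> * sqrt n"
        using sq by (simp add: pos_divide_le_eq)
      then have q: "sqnorm n (proj_perp n (Z n \<omega>) k (mu n \<omega>)) \<le> \<tau> * sqrt n"
        using sqnorm_proj_perp_mono[OF k(1) finite_of_subsets_card[OF k(2)], of n "Z n \<omega>" "mu n \<omega>"] by linarith
      have noise: "noise_size n (Z n \<omega>) (mu n \<omega>) (eps n \<omega>) m \<le> \<tau> * sqrt n" if "m \<in> ?I n" for m
        using nb \<omega> that by (force simp: not_less)
      have "card (?I n) > 0" using k(2) by (auto simp: card_gt_0_iff)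
      then have "ln (card (?I n)) \<le> u n * ln (p n)"
        using ln_mono[OF card_subsets_card_le_exp[OF u_le_p[of n]]] by simp
      then have "\<alpha> * ln (card (?I n)) \<le> \<alpha> * (c * sqrt n)" using uc \<alpha>0 by (intro mult_left_mono) auto
      also have "\<dots> \<le> \<tau> * sqrt n" using mult_right_mono[OF c(2), of "sqrt n"] by (simp add: mult.assoc)
      finally have A: "\<alpha> * ln (card (?I n)) \<le> \<tau> * sqrt n" .
      let ?est = "est \<alpha> n (p n) (u n) (Z n \<omega>) (Y n \<omega>)"
      let ?T = "sqnorm n (mu n \<omega>) + 2 * inprod n (mu n \<omega>) (eps n \<omega>)"
      have "\<bar>n * ?est - ?T\<bar> \<le> 14 * (\<tau> * sqrt n) + 5 * (\<tau> * sqrt n) + 3 * (\<alpha> * ln (card (?I n)))"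
        unfolding Y_def
        by (rule ew_estimators_deterministic[OF u_le_p \<alpha>0 k(2) q noise[unfolded noise_size_def] est])
      also have "\<dots> \<le> d * sqrt n" using A by (simp add: \<tau>_def)
      finally have main: "\<bar>n * ?est - ?T\<bar> \<le> d * sqrt n" .
      have sum: "(\<Sum>i<n. h (eps n \<omega> i) (mu n \<omega> i)) = ?T - n * \<sigma>\<mu>2"
        by (simp add: h_def sqnorm_def inprod_def sum.distrib sum_subtractf sum_distrib_left mult.assoc)
      have "sqrt n * R n \<omega> = n * ?est - n * \<sigma>\<mu>2"
        by (simp add: R_def mult.assoc[symmetric] right_diff_distrib)
      moreover have "sqrt n * X n \<omega> = ?T - n * \<sigma>\<mu>2"
        using sq unfolding X_def sum by simp
      ultimately have "sqrt n * (R n \<omega> - X n \<omega>) = n * ?est - ?T"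
        unfolding right_diff_distrib by linarith
      then have "sqrt n * \<bar>R n \<omega> - X n \<omega>\<bar> \<le> sqrt n * d"
        using main sq by (metis abs_mult abs_of_pos mult.commute)
      then show False using sq \<omega> by simp
    qed
    have meas: "?bad n \<in> events" "?far n \<in> events" for n
    proof -
      have "(\<lambda>\<omega>. proj_perp n (Z n \<omega>) m (y \<omega>) i) \<in> borel_measurable M"
        if "finite m" "\<And>i. (\<lambda>\<omega>. y \<omega> i) \<in> borel_measurable M" for m y i
        unfolding proj_perp_def using that
        by (intro borel_measurable_diff measurable_proj) auto
      note P = this
      have "(\<lambda>\<omega>. noise_size n (Z n \<omega>) (mu n \<omega>) (eps n \<omega>) m) \<in> borel_measurable M" if "m \<in> ?I n" for m
        unfolding noise_size_def using finite_of_subsets_card[OF that]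
        by (intro borel_measurable_add borel_measurable_divide borel_measurable_power
            measurable_sqnorm measurable_inprod P measurable_proj eps_rv mu_rv Z_rv)
      then have "(\<Union>m\<in>?I n. {\<omega>\<in>space M. noise_size n (Z n \<omega>) (mu n \<omega>) (eps n \<omega>) m > \<tau> * sqrt n}) \<in> events"
        by (intro sets.finite_UN) auto
      also have "(\<Union>m\<in>?I n. {\<omega>\<in>space M. noise_size n (Z n \<omega>) (mu n \<omega>) (eps n \<omega>) m > \<tau> * sqrt n}) = ?bad n"
        by auto
      finally show "?bad n \<in> events" .
      have "(\<lambda>\<omega>. ?Q n \<omega>) \<in> borel_measurable M"
        using finite_of_subsets_card[OF S_card[of n]]
        by (intro borel_measurable_divide measurable_sqnorm P mu_rv borel_measurable_const)
      then show "?far n \<in> events" by measurable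
    qed
    have far0: "(\<lambda>n. prob (?far n)) \<longlonglongrightarrow> 0"
      using sparse \<tau> unfolding tendsto_prob_zero_def by blast
    have "filterlim (\<lambda>n. 2 * c * sqrt (real n)) at_top sequentially"
      using c(1) by (intro filterlim_tendsto_pos_mult_at_top[OF tendsto_const]
          sqrt_at_top[THEN filterlim_compose] filterlim_real_sequentially) auto
    then have "(\<lambda>n. exp (- (2 * c * sqrt (real n)))) \<longlonglongrightarrow> 0"
      by (intro filterlim_compose[OF exp_at_bot] filterlim_compose[OF filterlim_uminus_at_bot_at_top])
    then have "(\<lambda>n. 2 * exp (- (2 * c * sqrt (real n)))) \<longlonglongrightarrow> 0"
      by (rule tendsto_mult_right_zero)
    then have lim: "(\<lambda>n. 2 * exp (- (2 * c * sqrt (real n))) + prob (?far n)) \<longlonglongrightarrow> 0"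
      using far0 by (rule tendsto_add_zero)
    show "(\<lambda>n. prob {\<omega>\<in>space M. \<bar>R n \<omega> - X n \<omega>\<bar> > d}) \<longlonglongrightarrow> 0"
    proof (rule tendsto_sandwich[OF _ _ tendsto_const lim])
      show "\<forall>\<^sub>F n in sequentially. prob {\<omega>\<in>space M. \<bar>R n \<omega> - X n \<omega>\<bar> > d}
          \<le> 2 * exp (- (2 * c * sqrt (real n))) + prob (?far n)"
        using u_ge_s sparsity_bounds[OF u_small c(1)] eventually_gt_at_top[of 0]
      proof eventually_elim
        case (elim n)
        have "prob {\<omega>\<in>space M. \<bar>R n \<omega> - X n \<omega>\<bar> > d} \<le> prob (?bad n \<union> ?far n)"
          using elim meas by (intro finite_measure_mono incl) auto
        also have "\<dots> \<le> prob (?bad n) + prob (?far n)"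
          using meas by (intro measure_Un_le)
        finally show ?case using bad_le[of n] elim by linarith
      qed
    qed simp
  qed
  then have "(\<lambda>n. char (distr M borel (R n)) t) \<longlonglongrightarrow> char (normal_measure v) t" for t
    by (rule slutsky_char[OF Xm Rm _ X_char])
  then have "weak_conv_m (\<lambda>n. distr M borel (R n)) (normal_measure v)"
    by (rule levy_continuity[OF real_distribution_distr[OF Rm] real_distribution_normal_measure[OF v0]])
  then show "weak_conv_m
      (\<lambda>n. distr M borel (\<lambda>\<omega>. sqrt (real n) * (est \<alpha> n (p n) (u n) (Z n \<omega>) (Y n \<omega>) - \<sigma>\<mu>2)))
      (normal_measure (\<kappa>\<mu> + 4 * \<sigma>\<epsilon>2 * \<sigma>\<mu>2))"
    unfolding R_def[abs_def] v_def .
qed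

end
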